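(* The group $\pi(\mathbf A_7)$ is not a free group, and $\pi(\mathbf A_n)$ is not a free group for every $n\ge7$.
   Context: Catalan groupoids: let $\mathbf I$ (resp. $\dot{\mathbf I}$) be the indiscrete (resp. discrete) category with two objects $0,1$. Groupoids $\mathbf A_n$ ($n\ge1$) and functors $U_{a,b}:\mathbf A_a\times\mathbf A_b\to\mathbf A_{a+b}$, $V_{i,j,k}:\mathbf A_i\times\mathbf A_j\times\mathbf A_k\times\mathbf I\to\mathbf A_{i+j+k}$ are defined inductively (indices positive). $\mathbf A_1=\mathbf 1$ is the trivial category with one object. For $n\ge2$, $\mathbf A_n$ is the pushout of categories of $$\coprod_{i+j+k=n}\mathbf A_i\times\mathbf A_j\times\mathbf A_k\times\mathbf I\ \hookleftarrow\ \coprod_{i+j+k=n}\mathbf A_i\times\mathbf A_j\times\mathbf A_k\times\dot{\mathbf I}\ \xrightarrow{W_{i,j,k}}\ \coprod_{a+b=n}\mathbf A_a\times\mathbf A_b,$$ $W_{i,j,k}(f,g,h,0)=(f,U_{j,k}(g,h))$, $W_{i,j,k}(f,g,h,1)=(U_{i,j}(f,g),h)$ (similarly on morphisms); $V_{i,j,k},U_{a,b}$ are the structure maps. Maximal indiscrete subgroupoids: $\mathbf T_1=\mathbf 1$, and for $n\ge2$, $\mathbf T_n$ is defined by the same inductive pushout with $\mathbf T$ in place of $\mathbf A$ and with only the terms $j=1$ allowed in the two left-hand coproducts, i.e. the pushout of $\coprod_{i+1+k=n}\mathbf T_i\times\mathbf T_1\times\mathbf T_k\times\mathbf I\hookleftarrow\coprod_{i+1+k=n}\mathbf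 T_i\times\mathbf T_1\times\mathbf T_k\times\dot{\mathbf I}\to\coprod_{a+b=n}\mathbf T_a\times\mathbf T_b$. There is an evident inclusion $L_n:\mathbf T_n\to\mathbf A_n$ (induced inductively by the pushout), which is bijective on objects, and $\mathbf T_n$ is indiscrete (exactly one morphism between any two objects). The group $\pi(\mathbf A_n)$ (the fundamental group of $\mathbf A_n$) is the pushout (in categories) of $\mathbf 1\leftarrow\mathbf T_n\xrightarrow{L_n}\mathbf A_n$, a one-object groupoid viewed as a group. *)

theory Defs
  imports "HOL-Algebra.Group" "HOL-Library.Countable"
begin

section \<open>Small categories and functors\<close>

record ('o, 'm) cat =
  Obj :: "'o set"
  Arr :: "'m set"
  Dom :: "'m \<Rightarrow> 'o"
  Cod :: "'m \<Rightarrow> 'o"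
  Id :: "'o \<Rightarrow> 'm"
  Comp :: "'m \<Rightarrow> 'm \<Rightarrow> 'm"  \<comment> \<open>\<open>Comp C g f\<close> is g after f, meaningful if \<open>Cod C f = Dom C g\<close>\<close>

locale category =
  fixes C :: "('o, 'm) cat"
  assumes dom_obj: "f \<in> Arr C \<Longrightarrow> Dom C f \<in> Obj C"
    and cod_obj: "f \<in> Arr C \<Longrightarrow> Cod C f \<in> Obj C"
    and id_arr: "x \<in> Obj C \<Longrightarrow> Id C x \<in> Arr C"
    and dom_id: "x \<in> Obj C \<Longrightarrow> Dom C (Id C x) = x"
    and cod_id: "x \<in> Obj C \<Longrightarrow> Cod C (Id C x) = x"
    and comp_arr: "\<lbrakk>f \<in> Arr C; g \<in> Arr C; Cod C f = Dom C g\<rbrakk> \<Longrightarrow> Comp C g f \<in> Arr C"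
    and dom_comp: "\<lbrakk>f \<in> Arr C; g \<in> Arr C; Cod C f = Dom C g\<rbrakk> \<Longrightarrow> Dom C (Comp C g f) = Dom C f"
    and cod_comp: "\<lbrakk>f \<in> Arr C; g \<in> Arr C; Cod C f = Dom C g\<rbrakk> \<Longrightarrow> Cod C (Comp C g f) = Cod C g"
    and comp_id: "f \<in> Arr C \<Longrightarrow> Comp C f (Id C (Dom C f)) = f"
    and id_comp: "f \<in> Arr C \<Longrightarrow> Comp C (Id C (Cod C f)) f = f"
    and comp_assoc: "\<lbrakk>f \<in> Arr C; g \<in> Arr C; h \<in> Arr C; Cod C f = Dom C g; Cod C g = Dom C h\<rbrakk>
        \<Longrightarrow> Comp C h (Comp C g f) = Comp C (Comp C h g) f"

text \<open>Only the values of a functor on the objects and arrows of its source are meaningful.\<close>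

record ('o, 'm, 'p, 'n) ftr =
  ob :: "'o \<Rightarrow> 'p"
  ar :: "'m \<Rightarrow> 'n"

locale cat_functor = source: category C + target: category D
  for C :: "('o, 'm) cat" and D :: "('p, 'n) cat" +
  fixes F :: "('o, 'm, 'p, 'n) ftr"
  assumes ob_in: "x \<in> Obj C \<Longrightarrow> ob F x \<in> Obj D"
    and ar_in: "f \<in> Arr C \<Longrightarrow> ar F f \<in> Arr D"
    and dom_ar: "f \<in> Arr C \<Longrightarrow> Dom D (ar F f) = ob F (Dom C f)"
    and cod_ar: "f \<in> Arr C \<Longrightarrow> Cod D (ar F f) = ob F (Cod C f)"
    and ar_id: "x \<in> Obj C \<Longrightarrow> ar F (Id C x) = Id D (ob F x)"
    and ar_comp: "\<lbrakk>f \<in> Arr C; g \<in> Arr C; Cod C f = Dom C g\<rbrakk>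
        \<Longrightarrow> ar F (Comp C g f) = Comp D (ar F g) (ar F f)"

definition eq_ftr_on :: "('o, 'm) cat \<Rightarrow> ('o, 'm, 'p, 'n) ftr \<Rightarrow> ('o, 'm, 'p, 'n) ftr \<Rightarrow> bool"
  where "eq_ftr_on C F G \<longleftrightarrow>
    (\<forall>x\<in>Obj C. ob F x = ob G x) \<and> (\<forall>f\<in>Arr C. ar F f = ar G f)"

definition id_ftr :: "('o, 'm, 'o, 'm) ftr"
  where "id_ftr = \<lparr>ob = (\<lambda>x. x), ar = (\<lambda>f. f)\<rparr>"

definition comp_ftr :: "('p, 'n, 'q, 'r) ftr \<Rightarrow> ('o, 'm, 'p, 'n) ftr \<Rightarrow> ('o, 'm, 'q, 'r) ftr"
  where "comp_ftr G F = \<lparr>ob = (\<lambda>x. ob G (ob F x)), ar = (\<lambda>f. ar G (ar F f))\<rparr>"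


section \<open>Elementary constructions\<close>

definition one_cat :: "(nat, nat) cat"
  where "one_cat = \<lparr>Obj = {0}, Arr = {0}, Dom = (\<lambda>_. 0), Cod = (\<lambda>_. 0),
    Id = (\<lambda>_. 0), Comp = (\<lambda>_ _. 0)\<rparr>"

definition to_one :: "('o, 'm, nat, nat) ftr"
  where "to_one = \<lparr>ob = (\<lambda>_. 0), ar = (\<lambda>_. 0)\<rparr>"

text \<open>The pair \<open>(x, y)\<close> is the unique arrow from x to y.  The discrete category on S is thus
  literally a subcategory of the indiscrete one.\<close>

definition indiscrete :: "'a set \<Rightarrow> ('a, 'a \<times> 'a) cat"
  where "indiscrete S = \<lparr>Obj = S, Arr = S \<times> S, Dom = fst, Cod = snd,
    Id = (\<lambda>x. (x, x)), Comp = (\<lambda>g f. (fst f, snd g))\<rparr>"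

definition discrete :: "'a set \<Rightarrow> ('a, 'a \<times> 'a) cat"
  where "discrete S = \<lparr>Obj = S, Arr = {(x, x) | x. x \<in> S}, Dom = fst, Cod = snd,
    Id = (\<lambda>x. (x, x)), Comp = (\<lambda>g f. (fst f, snd g))\<rparr>"

definition prod_cat :: "('o, 'm) cat \<Rightarrow> ('p, 'n) cat \<Rightarrow> ('o \<times> 'p, 'm \<times> 'n) cat"
  where "prod_cat C D = \<lparr>Obj = Obj C \<times> Obj D, Arr = Arr C \<times> Arr D,
    Dom = map_prod (Dom C) (Dom D), Cod = map_prod (Cod C) (Cod D),
    Id = map_prod (Id C) (Id D),
    Comp = (\<lambda>(g, g') (f, f'). (Comp C g f, Comp D g' f'))\<rparr>"

text \<open>The restriction makes the coproduct depend only on the summands with index in I, which the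
  recursion below needs.\<close>

definition coprod_cat :: "'i set \<Rightarrow> ('i \<Rightarrow> ('o, 'm) cat) \<Rightarrow> ('i \<times> 'o, 'i \<times> 'm) cat"
  where "coprod_cat I C = \<lparr>Obj = Sigma I (\<lambda>i. Obj (C i)), Arr = Sigma I (\<lambda>i. Arr (C i)),
    Dom = (\<lambda>(i, f). (i, Dom (restrict C I i) f)), Cod = (\<lambda>(i, f). (i, Cod (restrict C I i) f)),
    Id = (\<lambda>(i, x). (i, Id (restrict C I i) x)),
    Comp = (\<lambda>(i, g) (_, f). (i, Comp (restrict C I i) g f))\<rparr>"

definition sum_cat :: "('o, 'm) cat \<Rightarrow> ('p, 'n) cat \<Rightarrow> ('o + 'p, 'm + 'n) cat"
  where "sum_cat C D = \<lparr>Obj = Obj C <+> Obj D, Arr = Arr C <+> Arr D,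
    Dom = map_sum (Dom C) (Dom D), Cod = map_sum (Cod C) (Cod D),
    Id = map_sum (Id C) (Id D),
    Comp = (\<lambda>g f. case (g, f) of
        (Inl g', Inl f') \<Rightarrow> Inl (Comp C g' f')
      | (Inr g', Inr f') \<Rightarrow> Inr (Comp D g' f')
      | _ \<Rightarrow> undefined)\<rparr>"

definition image_cat :: "('o \<Rightarrow> 'p) \<Rightarrow> ('m \<Rightarrow> 'n) \<Rightarrow> ('o, 'm) cat \<Rightarrow> ('p, 'n) cat"
  where "image_cat \<phi> \<psi> C =
    (let \<phi>' = inv_into (Obj C) \<phi>; \<psi>' = inv_into (Arr C) \<psi> in
     \<lparr>Obj = \<phi> ` Obj C, Arr = \<psi> ` Arr C,
      Dom = (\<lambda>f. \<phi> (Dom C (\<psi>' f))), Cod = (\<lambda>f. \<phi> (Cod C (\<psi>' f))),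
      Id = (\<lambda>x. \<psi> (Id C (\<phi>' x))), Comp = (\<lambda>g f. \<psi> (Comp C (\<psi>' g) (\<psi>' f)))\<rparr>)"


section \<open>Pushouts of categories\<close>

text \<open>
  \<open>quot_cat S R Q\<close> is obtained from S by universally identifying the pairs of objects in R and the
  pairs of arrows in Q.  An arrow is a class of paths \<open>(x, [f\<^sub>1, \<dots>, f\<^sub>n])\<close>, listed in the order of
  traversal, that start at the class of x and are composable up to the identification of objects.
\<close>

definition eq_class :: "('a \<times> 'a) set \<Rightarrow> 'a \<Rightarrow> 'a set"
  where "eq_class R x = ((R \<union> R\<inverse>)\<^sup>*) `` {x}"

fun chain :: "('o, 'm) cat \<Rightarrow> ('o \<Rightarrow> 'q) \<Rightarrow> 'q \<Rightarrow> 'm list \<Rightarrow> bool"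
  where
    "chain S q X [] = True"
  | "chain S q X (f # fs) = (f \<in> Arr S \<and> q (Dom S f) = X \<and> chain S q (q (Cod S f)) fs)"

fun chain_end :: "('o, 'm) cat \<Rightarrow> ('o \<Rightarrow> 'q) \<Rightarrow> 'q \<Rightarrow> 'm list \<Rightarrow> 'q"
  where
    "chain_end S q X [] = X"
  | "chain_end S q X (f # fs) = chain_end S q (q (Cod S f)) fs"

definition paths :: "('o, 'm) cat \<Rightarrow> ('o \<times> 'o) set \<Rightarrow> ('o \<times> 'm list) set"
  where "paths S R = {(x, fs). x \<in> Obj S \<and> chain S (eq_class R) (eq_class R x) fs}"

definition elem_rel :: "('o, 'm) cat \<Rightarrow> ('m \<times> 'm) set \<Rightarrow> ('m list \<times> 'm list) set"
  where "elem_rel S Q =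
    {([Id S x], []) | x. x \<in> Obj S} \<union>
    {([f, g], [Comp S g f]) | f g. f \<in> Arr S \<and> g \<in> Arr S \<and> Cod S f = Dom S g} \<union>
    {([f], [g]) | f g. (f, g) \<in> Q}"

definition path_rel :: "('o, 'm) cat \<Rightarrow> ('o \<times> 'o) set \<Rightarrow> ('m \<times> 'm) set
    \<Rightarrow> (('o \<times> 'm list) \<times> ('o \<times> 'm list)) set"
  where "path_rel S R Q =
    {((x, us @ l @ vs), (y, us @ r @ vs)) | x y us vs l r.
        eq_class R x = eq_class R y \<and> ((l, r) \<in> elem_rel S Q \<or> l = r)}
    \<inter> (paths S R \<times> paths S R)"

definition some_elem :: "'a set \<Rightarrow> 'a"
  where "some_elem X = (SOME x. x \<in> X)"

definition quot_cat :: "('o, 'm) cat \<Rightarrow> ('o \<times> 'o) set \<Rightarrow> ('m \<times> 'm) set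
    \<Rightarrow> ('o set, ('o \<times> 'm list) set) cat"
  where "quot_cat S R Q =
    (let q = eq_class R; p = eq_class (path_rel S R Q) in
     \<lparr>Obj = q ` Obj S,
      Arr = p ` paths S R,
      Dom = (\<lambda>c. q (fst (some_elem c))),
      Cod = (\<lambda>c. case some_elem c of (x, fs) \<Rightarrow> chain_end S q (q x) fs),
      Id = (\<lambda>X. p (some_elem X, [])),
      Comp = (\<lambda>d c. case (some_elem c, some_elem d) of
                ((x, fs), (_, gs)) \<Rightarrow> p (x, fs @ gs))\<rparr>)"

definition quot_ftr :: "('o, 'm) cat \<Rightarrow> ('o \<times> 'o) set \<Rightarrow> ('m \<times> 'm) set
    \<Rightarrow> ('o, 'm, 'o set, ('o \<times> 'm list) set) ftr"
  where "quot_ftr S R Q =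
    \<lparr>ob = eq_class R, ar = (\<lambda>f. eq_class (path_rel S R Q) (Dom S f, [f]))\<rparr>"

text \<open>The pushout of \<open>D \<leftarrow>F- C -G\<rightarrow> E\<close>, with its two structure functors.\<close>

definition po_ob_rel :: "('o, 'm) cat \<Rightarrow> ('o, 'm, 'p, 'n) ftr \<Rightarrow> ('o, 'm, 'q, 'r) ftr
    \<Rightarrow> (('p + 'q) \<times> ('p + 'q)) set"
  where "po_ob_rel C F G = {(Inl (ob F x), Inr (ob G x)) | x. x \<in> Obj C}"

definition po_ar_rel :: "('o, 'm) cat \<Rightarrow> ('o, 'm, 'p, 'n) ftr \<Rightarrow> ('o, 'm, 'q, 'r) ftr
    \<Rightarrow> (('n + 'r) \<times> ('n + 'r)) set"
  where "po_ar_rel C F G = {(Inl (ar F f), Inr (ar G f)) | f. f \<in> Arr C}"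

definition pushout :: "('o, 'm) cat \<Rightarrow> ('p, 'n) cat \<Rightarrow> ('q, 'r) cat
    \<Rightarrow> ('o, 'm, 'p, 'n) ftr \<Rightarrow> ('o, 'm, 'q, 'r) ftr
    \<Rightarrow> (('p + 'q) set, (('p + 'q) \<times> ('n + 'r) list) set) cat"
  where "pushout C D E F G =
    quot_cat (sum_cat D E) (po_ob_rel C F G) (po_ar_rel C F G)"

definition pushout_left :: "('o, 'm) cat \<Rightarrow> ('p, 'n) cat \<Rightarrow> ('q, 'r) cat
    \<Rightarrow> ('o, 'm, 'p, 'n) ftr \<Rightarrow> ('o, 'm, 'q, 'r) ftr
    \<Rightarrow> ('p, 'n, ('p + 'q) set, (('p + 'q) \<times> ('n + 'r) list) set) ftr"
  where "pushout_left C D E F G =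
    comp_ftr (quot_ftr (sum_cat D E) (po_ob_rel C F G) (po_ar_rel C F G)) \<lparr>ob = Inl, ar = Inl\<rparr>"

definition pushout_right :: "('o, 'm) cat \<Rightarrow> ('p, 'n) cat \<Rightarrow> ('q, 'r) cat
    \<Rightarrow> ('o, 'm, 'p, 'n) ftr \<Rightarrow> ('o, 'm, 'q, 'r) ftr
    \<Rightarrow> ('q, 'r, ('p + 'q) set, (('p + 'q) \<times> ('n + 'r) list) set) ftr"
  where "pushout_right C D E F G =
    comp_ftr (quot_ftr (sum_cat D E) (po_ob_rel C F G) (po_ar_rel C F G)) \<lparr>ob = Inr, ar = Inr\<rparr>"

text \<open>The functor \<open>P \<rightarrow> Z\<close> out of a pushout P, with structure functors I and J, that is induced by
  \<open>H : D \<rightarrow> Z\<close> and \<open>K : E \<rightarrow> Z\<close>.\<close>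

definition induced_ftr :: "('p, 'n) cat \<Rightarrow> ('q, 'r) cat \<Rightarrow> ('s, 't) cat
    \<Rightarrow> ('p, 'n, 's, 't) ftr \<Rightarrow> ('q, 'r, 's, 't) ftr \<Rightarrow> ('u, 'v) cat
    \<Rightarrow> ('p, 'n, 'u, 'v) ftr \<Rightarrow> ('q, 'r, 'u, 'v) ftr \<Rightarrow> ('s, 't, 'u, 'v) ftr"
  where "induced_ftr D E P I J Z H K =
    (SOME M. cat_functor P Z M \<and> eq_ftr_on D (comp_ftr M I) H \<and> eq_ftr_on E (comp_ftr M J) K)"


section \<open>The Catalan groupoids and their maximal indiscrete subgroupoids\<close>

text \<open>
  To iterate the pushout, each stage is transported to a category whose objects and arrows are
  natural numbers: a class in the pushout is encoded by the code of a chosen representative.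
  The set \<open>J\<close> consists of the allowed middle indices j: all positive integers for the groupoids
  \<open>\<^bold>A\<^sub>n\<close>, and only 1 for \<open>\<^bold>T\<^sub>n\<close>.
\<close>

definition encode :: "'a::countable set \<Rightarrow> nat"
  where "encode c = to_nat (some_elem c)"

type_synonym tri = "nat \<times> nat \<times> nat"

type_synonym ncat = "(nat, nat) cat"

type_synonym u_ftr = "(nat \<times> nat, nat \<times> nat, nat, nat) ftr"

definition pairs :: "nat \<Rightarrow> (nat \<times> nat) set"
  where "pairs n = {(a, b). 1 \<le> a \<and> 1 \<le> b \<and> a + b = n}"

definition triples :: "nat set \<Rightarrow> nat \<Rightarrow> tri set"
  where "triples J n = {(i, j, k). 1 \<le> i \<and> 1 \<le> j \<and> 1 \<le> k \<and> j \<in> J \<and> i + j + k = n}"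

definition pair_cat :: "nat \<Rightarrow> (nat \<Rightarrow> ncat)
    \<Rightarrow> ((nat \<times> nat) \<times> nat \<times> nat, (nat \<times> nat) \<times> nat \<times> nat) cat"
  where "pair_cat n A = coprod_cat (pairs n) (\<lambda>(a, b). prod_cat (A a) (A b))"

definition triple_cat :: "nat set \<Rightarrow> nat \<Rightarrow> (nat \<Rightarrow> ncat) \<Rightarrow> (nat, nat \<times> nat) cat
    \<Rightarrow> (tri \<times> nat \<times> nat \<times> nat \<times> nat, tri \<times> nat \<times> nat \<times> nat \<times> nat \<times> nat) cat"
  where "triple_cat J n A B = coprod_cat (triples J n)
    (\<lambda>(i, j, k). prod_cat (A i) (prod_cat (A j) (prod_cat (A k) B)))"

definition W_ftr :: "(nat \<Rightarrow> nat \<Rightarrow> u_ftr)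
    \<Rightarrow> (tri \<times> nat \<times> nat \<times> nat \<times> nat, tri \<times> nat \<times> nat \<times> nat \<times> nat \<times> nat,
        (nat \<times> nat) \<times> nat \<times> nat, (nat \<times> nat) \<times> nat \<times> nat) ftr"
  where "W_ftr U =
    \<lparr>ob = (\<lambda>((i, j, k), (x, y, z, t)).
        if t = 0 then ((i, j + k), (x, ob (U j k) (y, z)))
        else ((i + j, k), (ob (U i j) (x, y), z))),
     ar = (\<lambda>((i, j, k), (f, g, h, (t, t'))).
        if t = 0 then ((i, j + k), (f, ar (U j k) (g, h)))
        else ((i + j, k), (ar (U i j) (f, g), h)))\<rparr>"

record stage_data =
  st_cat :: ncat
  st_V :: "(tri \<times> nat \<times> nat \<times> nat \<times> nat, tri \<times> nat \<times> nat \<times> nat \<times> nat \<times> nat, nat, nat) ftr"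
  st_U :: "((nat \<times> nat) \<times> nat \<times> nat, (nat \<times> nat) \<times> nat \<times> nat, nat, nat) ftr"

definition U_of :: "(nat \<Rightarrow> stage_data) \<Rightarrow> nat \<Rightarrow> nat \<Rightarrow> u_ftr"
  where "U_of S a b = \<lparr>ob = (\<lambda>x. ob (st_U (S (a + b))) ((a, b), x)),
                       ar = (\<lambda>f. ar (st_U (S (a + b))) ((a, b), f))\<rparr>"

definition next_stage :: "nat set \<Rightarrow> nat \<Rightarrow> (nat \<Rightarrow> stage_data) \<Rightarrow> stage_data"
  where "next_stage J n S =
    (let A = (\<lambda>m. st_cat (S m));
         C = triple_cat J n A (discrete {0, 1});
         D = triple_cat J n A (indiscrete {0, 1});
         E = pair_cat n A;
         W = W_ftr (U_of S);
         code = \<lparr>ob = encode, ar = encode\<rparr>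
     in \<lparr>st_cat = image_cat encode encode (pushout C D E id_ftr W),
         st_V = comp_ftr code (pushout_left C D E id_ftr W),
         st_U = comp_ftr code (pushout_right C D E id_ftr W)\<rparr>)"

fun stage :: "nat set \<Rightarrow> nat \<Rightarrow> stage_data"
  where "stage J n =
    (if n \<le> 1 then \<lparr>st_cat = one_cat, st_V = to_one, st_U = to_one\<rparr>
     else next_stage J n (\<lambda>m. if m < n then stage J m else undefined))"

declare stage.simps [simp del]

definition A_cat :: "nat \<Rightarrow> ncat"
  where "A_cat n = st_cat (stage {1..} n)"

definition T_cat :: "nat \<Rightarrow> ncat"
  where "T_cat n = st_cat (stage {1} n)"

definition triple_ftr :: "(nat \<Rightarrow> (nat, nat, nat, nat) ftr)
    \<Rightarrow> (tri \<times> nat \<times> nat \<times> nat \<times> nat, tri \<times> nat \<times> nat \<times> nat \<times> nat \<times> nat,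
        tri \<times> nat \<times> nat \<times> nat \<times> nat, tri \<times> nat \<times> nat \<times> nat \<times> nat \<times> nat) ftr"
  where "triple_ftr L =
    \<lparr>ob = (\<lambda>((i, j, k), (x, y, z, t)). ((i, j, k), (ob (L i) x, ob (L j) y, ob (L k) z, t))),
     ar = (\<lambda>((i, j, k), (f, g, h, t)). ((i, j, k), (ar (L i) f, ar (L j) g, ar (L k) h, t)))\<rparr>"

definition pair_ftr :: "(nat \<Rightarrow> (nat, nat, nat, nat) ftr)
    \<Rightarrow> ((nat \<times> nat) \<times> nat \<times> nat, (nat \<times> nat) \<times> nat \<times> nat,
        (nat \<times> nat) \<times> nat \<times> nat, (nat \<times> nat) \<times> nat \<times> nat) ftr"
  where "pair_ftr L =
    \<lparr>ob = (\<lambda>((a, b), (x, y)). ((a, b), (ob (L a) x, ob (L b) y))),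
     ar = (\<lambda>((a, b), (f, g)). ((a, b), (ar (L a) f, ar (L b) g)))\<rparr>"

text \<open>\<open>L\<^sub>n : \<^bold>T\<^sub>n \<rightarrow> \<^bold>A\<^sub>n\<close> is induced by the functors \<open>L\<^sub>m\<close>, \<open>m < n\<close>, on the diagrams.\<close>

definition next_L :: "nat \<Rightarrow> (nat \<Rightarrow> (nat, nat, nat, nat) ftr) \<Rightarrow> (nat, nat, nat, nat) ftr"
  where "next_L n L =
    induced_ftr (triple_cat {1} n T_cat (indiscrete {0, 1})) (pair_cat n T_cat)
      (T_cat n) (st_V (stage {1} n)) (st_U (stage {1} n))
      (A_cat n) (comp_ftr (st_V (stage {1..} n)) (triple_ftr L))
                (comp_ftr (st_U (stage {1..} n)) (pair_ftr L))"

fun L_ftr :: "nat \<Rightarrow> (nat, nat, nat, nat) ftr"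
  where "L_ftr n =
    (if n \<le> 1 then id_ftr else next_L n (\<lambda>m. if m < n then L_ftr m else undefined))"

declare L_ftr.simps [simp del]


section \<open>The fundamental group and free groups\<close>

text \<open>The endomorphisms of the only object of a one-object category.\<close>

definition monoid_of :: "('o, 'm) cat \<Rightarrow> 'm monoid"
  where "monoid_of C = \<lparr>carrier = Arr C, mult = Comp C, one = Id C (THE x. x \<in> Obj C)\<rparr>"

definition pi_A :: "nat \<Rightarrow> ((nat + nat) \<times> (nat + nat) list) set monoid"
  where "pi_A n = monoid_of (pushout (T_cat n) one_cat (A_cat n) to_one (L_ftr n))"

text \<open>The free group on X consists of the reduced words in the letters x and their formal
  inverses, represented by \<open>(x, True)\<close> and \<open>(x, False)\<close>.\<close>

definition inverse_letters :: "'x \<times> bool \<Rightarrow> 'x \<times> bool \<Rightarrow> bool"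
  where "inverse_letters a b \<longleftrightarrow> fst a = fst b \<and> snd a \<noteq> snd b"

definition reduced :: "('x \<times> bool) list \<Rightarrow> bool"
  where "reduced w \<longleftrightarrow> successively (\<lambda>a b. \<not> inverse_letters a b) w"

fun cons_reduce :: "'x \<times> bool \<Rightarrow> ('x \<times> bool) list \<Rightarrow> ('x \<times> bool) list"
  where
    "cons_reduce a [] = [a]"
  | "cons_reduce a (b # w) = (if inverse_letters a b then w else a # b # w)"

definition free_group :: "'x set \<Rightarrow> ('x \<times> bool) list monoid"
  where "free_group X = \<lparr>carrier = {w. reduced w \<and> fst ` set w \<subseteq> X},
    mult = (\<lambda>u v. foldr cons_reduce u v), one = []\<rparr>"

text \<open>A basis can be taken inside the group, so it suffices to let X range over sets of its
  elements.\<close>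

definition is_free_group :: "'g monoid \<Rightarrow> bool"
  where "is_free_group G \<longleftrightarrow> (\<exists>X :: 'g set. G \<cong> free_group X)"


section \<open>Quotient categories and their universal property\<close>

lemma eq_class_eq_iff: "eq_class R x = eq_class R y \<longleftrightarrow> (x, y) \<in> (R \<union> R\<inverse>)\<^sup>*"
proof -
  have s: "sym ((R \<union> R\<inverse>)\<^sup>*)" by (intro sym_rtrancl) (auto simp: sym_def)
  show ?thesis
  proof
    assume "eq_class R x = eq_class R y"
    then have "y \<in> eq_class R x" by (auto simp: eq_class_def)
    then show "(x, y) \<in> (R \<union> R\<inverse>)\<^sup>*" by (simp add: eq_class_def)
  next
    assume a: "(x, y) \<in> (R \<union> R\<inverse>)\<^sup>*"
    then have b: "(y, x) \<in> (R \<union> R\<inverse>)\<^sup>*" using s by (auto simp: sym_def)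
    show "eq_class R x = eq_class R y" unfolding eq_class_def using a b
      by (auto intro: rtrancl_trans)
  qed
qed

lemma mem_eq_class: "y \<in> eq_class R x \<longleftrightarrow> eq_class R y = eq_class R x"
proof -
  have "y \<in> eq_class R x \<longleftrightarrow> eq_class R x = eq_class R y"
    unfolding eq_class_eq_iff by (simp add: eq_class_def)
  then show ?thesis by auto
qed

lemma eq_class_rel: "(x, y) \<in> R \<Longrightarrow> eq_class R x = eq_class R y"
  unfolding eq_class_eq_iff by auto

lemma eq_class_invariant:
  assumes "eq_class R x = eq_class R y" "\<And>u v. (u, v) \<in> R \<Longrightarrow> h u = h v"
  shows "h x = h y"
proof -
  have "(x, y) \<in> (R \<union> R\<inverse>)\<^sup>*" using assms(1) by (simp add: eq_class_eq_iff)
  then show ?thesis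
  proof induction
    case (step y z) then show ?case using assms(2)[of y z] assms(2)[of z y] by auto
  qed simp
qed

lemma some_elem_class: "eq_class R (some_elem (eq_class R x)) = eq_class R x"
proof -
  have "some_elem (eq_class R x) \<in> eq_class R x" unfolding some_elem_def
    by (rule someI[of _ x]) (simp add: mem_eq_class)
  then show ?thesis by (simp add: mem_eq_class)
qed

lemma some_elem_in:
  assumes "x \<in> A" "R \<subseteq> A \<times> A"
  shows "some_elem (eq_class R x) \<in> A"
  using eq_class_invariant[OF some_elem_class, of R "\<lambda>x. x \<in> A" x] assms by auto

lemma chain_append: "chain S q X (fs @ gs) \<longleftrightarrow> chain S q X fs \<and> chain S q (chain_end S q X fs) gs"
  by (induction fs arbitrary: X) auto

lemma chain_end_append: "chain_end S q X (fs @ gs) = chain_end S q (chain_end S q X fs) gs"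
  by (induction fs arbitrary: X) auto

definition path_val :: "('p, 'n) cat \<Rightarrow> ('m \<Rightarrow> 'n) \<Rightarrow> 'n \<Rightarrow> 'm list \<Rightarrow> 'n"
  where "path_val Z h a fs = foldl (\<lambda>a f. Comp Z (h f) a) a fs"

locale quot = category S for S :: "('o, 'm) cat" +
  fixes R :: "('o \<times> 'o) set" and Q :: "('m \<times> 'm) set"
  assumes R: "R \<subseteq> Obj S \<times> Obj S" and Q: "Q \<subseteq> Arr S \<times> Arr S"
    and Qd: "(f, g) \<in> Q \<Longrightarrow> eq_class R (Dom S f) = eq_class R (Dom S g)"
    and Qc: "(f, g) \<in> Q \<Longrightarrow> eq_class R (Cod S f) = eq_class R (Cod S g)"
begin

abbreviation "q \<equiv> eq_class R"
abbreviation "p \<equiv> eq_class (path_rel S R Q)"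
abbreviation "P \<equiv> paths S R"
abbreviation "K \<equiv> quot_cat S R Q"
abbreviation "e X fs \<equiv> chain_end S q X fs"

lemma elem_end: "\<lbrakk>(l, r) \<in> elem_rel S Q; chain S q X l\<rbrakk> \<Longrightarrow> e X l = e X r"
  unfolding elem_rel_def using Qc by (auto simp: cod_comp cod_id dom_id)

lemma elem_chain: "\<lbrakk>(l, r) \<in> elem_rel S Q; chain S q X l\<rbrakk> \<Longrightarrow> chain S q X r"
  unfolding elem_rel_def using Qd Q by (auto simp: dom_comp comp_arr)

lemma rel_inv: "(a, b) \<in> path_rel S R Q \<Longrightarrow>
   a \<in> P \<and> b \<in> P \<and> q (fst a) = q (fst b) \<and> e (q (fst a)) (snd a) = e (q (fst b)) (snd b)"
proof -
  assume "(a, b) \<in> path_rel S R Q"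
  then obtain x y us vs l r where 1: "a = (x, us @ l @ vs)" "b = (y, us @ r @ vs)" "q x = q y"
      "(l, r) \<in> elem_rel S Q \<or> l = r" and P: "a \<in> P" "b \<in> P"
    unfolding path_rel_def by auto
  have "chain S q (e (q x) us) l" using 1 P by (auto simp: paths_def chain_append)
  then have "e (e (q x) us) l = e (e (q x) us) r" using elem_end 1 by blast
  then show ?thesis using 1 P by (simp add: chain_end_append)
qed

lemma some_path: "a \<in> P \<Longrightarrow> some_elem (p a) \<in> P"
  by (rule some_elem_in) (auto dest: rel_inv)

lemma peq_start: "p a = p b \<Longrightarrow> q (fst a) = q (fst b)"
  by (erule eq_class_invariant) (auto dest: rel_inv)

lemma peq_end: "p a = p b \<Longrightarrow> e (q (fst a)) (snd a) = e (q (fst b)) (snd b)"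
  by (erule eq_class_invariant) (auto dest: rel_inv)

lemma peq_path: "p a = p b \<Longrightarrow> a \<in> P \<longleftrightarrow> b \<in> P"
  by (erule eq_class_invariant) (auto dest: rel_inv)

lemma rel_ctx:
  assumes "((x, fs), (x', fs')) \<in> path_rel S R Q"
    "(y, us @ fs @ vs) \<in> P" "e (q y) us = q x"
  shows "((y, us @ fs @ vs), (y, us @ fs' @ vs)) \<in> path_rel S R Q"
proof -
  obtain a l b r where 1: "fs = a @ l @ b" "fs' = a @ r @ b" "q x = q x'" "(l, r) \<in> elem_rel S Q \<or> l = r"
    and P: "(x, fs) \<in> P" "(x', fs') \<in> P"
    using assms(1) unfolding path_rel_def by auto
  have "(y, us @ fs' @ vs) \<in> P"
    using rel_inv[OF assms(1)] assms(2,3) P by (auto simp: paths_def chain_append chain_end_append)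
  moreover have "us @ fs @ vs = (us @ a) @ l @ (b @ vs)" "us @ fs' @ vs = (us @ a) @ r @ (b @ vs)"
    using 1 by auto
  ultimately show ?thesis unfolding path_rel_def using assms(2) 1 by blast
qed

lemma peq_ctx:
  assumes "p (x, fs) = p (x', fs')"
    "(y, us @ fs @ vs) \<in> P" "e (q y) us = q x"
  shows "p (y, us @ fs @ vs) = p (y, us @ fs' @ vs)"
proof -
  have "((x, fs), (x', fs')) \<in> (path_rel S R Q \<union> (path_rel S R Q)\<inverse>)\<^sup>*"
    using assms(1) by (simp add: eq_class_eq_iff)
  then have "p (y, us @ fs @ vs) = p (y, us @ fs' @ vs) \<and> (y, us @ fs' @ vs) \<in> P \<and> q x' = q x"
  proof (induction rule: rtrancl_induct2)
    case refl then show ?case using assms by simp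
  next
    case (step a as b bs)
    have "((a, as), b, bs) \<in> path_rel S R Q \<or> ((b, bs), a, as) \<in> path_rel S R Q" using step by auto
    then show ?case
    proof
      assume *: "((a, as), b, bs) \<in> path_rel S R Q"
      from rel_ctx[OF this, of y us vs] step assms have
        **: "((y, us @ as @ vs), (y, us @ bs @ vs)) \<in> path_rel S R Q" by simp
      show ?thesis using step rel_inv[OF **] rel_inv[OF *] eq_class_rel[OF **] by simp
    next
      assume *: "((b, bs), a, as) \<in> path_rel S R Q"
      have "(y, us @ bs @ vs) \<in> P"
        using rel_inv[OF *] assms(3) step
        by (auto simp: paths_def chain_append)
      from rel_ctx[OF * this] step assms rel_inv[OF *] have
        **: "((y, us @ bs @ vs), (y, us @ as @ vs)) \<in> path_rel S R Q" by simp
      show ?thesis using step rel_inv[OF **] rel_inv[OF *] eq_class_rel[OF **] by simp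
    qed
  qed
  then show ?thesis by simp
qed

lemma peq_base: "\<lbrakk>(x, fs) \<in> P; y \<in> Obj S; q x = q y\<rbrakk> \<Longrightarrow> p (x, fs) = p (y, fs) \<and> (y, fs) \<in> P"
proof -
  assume a: "(x, fs) \<in> P" "y \<in> Obj S" "q x = q y"
  then have b: "(y, fs) \<in> P" by (auto simp: paths_def)
  have "((x, [] @ fs @ []), (y, [] @ fs @ [])) \<in> path_rel S R Q"
    unfolding path_rel_def using a b by (simp, blast)
  then have "((x, fs), (y, fs)) \<in> path_rel S R Q" by simp
  from eq_class_rel[OF this] show ?thesis using b by simp
qed

lemma peq_elem: "\<lbrakk>(x, us @ l @ vs) \<in> P; (l, r) \<in> elem_rel S Q\<rbrakk> \<Longrightarrow> p (x, us @ l @ vs) = p (x, us @ r @ vs) "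
proof (rule eq_class_rel)
  assume a: "(x, us @ l @ vs) \<in> P" "(l, r) \<in> elem_rel S Q"
  then have "(x, us @ r @ vs) \<in> P"
    using elem_end[of l r] elem_chain[of l r] by (auto simp: paths_def chain_append)
  then show "((x, us @ l @ vs), (x, us @ r @ vs)) \<in> path_rel S R Q"
    unfolding path_rel_def using a by blast
qed

lemma path_end: "(x, fs) \<in> P \<Longrightarrow> \<exists>y\<in>Obj S. e (q x) fs = q y"
proof -
  have "chain S q X fs \<Longrightarrow> \<exists>y\<in>Obj S. X = q y \<Longrightarrow> \<exists>y\<in>Obj S. e X fs = q y" for X
    by (induction fs arbitrary: X) (auto intro: cod_obj)
  then show "(x, fs) \<in> P \<Longrightarrow> \<exists>y\<in>Obj S. e (q x) fs = q y" by (auto simp: paths_def)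
qed

lemma K_obj: "Obj K = q ` Obj S" by (simp add: quot_cat_def Let_def)
lemma K_arr: "Arr K = p ` P" by (simp add: quot_cat_def Let_def)
lemma K_arrE: "c \<in> Arr K \<Longrightarrow> (\<And>x fs. c = p (x, fs) \<Longrightarrow> (x, fs) \<in> P \<Longrightarrow> thesis) \<Longrightarrow> thesis"
  by (auto simp: K_arr)
lemma K_dom: "Dom K (p (x, fs)) = q x"
  using peq_start[OF some_elem_class, of "(x, fs)"] by (simp add: quot_cat_def Let_def)
lemma K_cod: "Cod K (p (x, fs)) = e (q x) fs"
  using peq_end[OF some_elem_class, of "(x, fs)"] by (simp add: quot_cat_def Let_def case_prod_unfold)
lemma K_id: "x \<in> Obj S \<Longrightarrow> Id K (q x) = p (x, [])"
proof -
  assume x: "x \<in> Obj S"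
  then have "(x, []) \<in> P" by (simp add: paths_def)
  from peq_base[OF this some_elem_in[OF x R]] show ?thesis
    by (simp add: quot_cat_def Let_def some_elem_class)
qed
lemma K_comp: assumes "(x, fs) \<in> P" "(y, gs) \<in> P" "e (q x) fs = q y"
  shows "Comp K (p (y, gs)) (p (x, fs)) = p (x, fs @ gs)" "(x, fs @ gs) \<in> P"
proof -
  obtain x' fs' where 1: "some_elem (p (x, fs)) = (x', fs')" by fastforce
  obtain y' gs' where 2: "some_elem (p (y, gs)) = (y', gs')" by fastforce
  have e1: "p (x, fs) = p (x', fs')" using some_elem_class 1 by metis
  have e2: "p (y, gs) = p (y', gs')" using some_elem_class 2 by metis
  have s: "q x = q x'" "q y = q y'" using peq_start[OF e1] peq_start[OF e2] by auto
  have t: "e (q x) fs = e (q x') fs'"  using peq_end[OF e1] by auto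
  have P': "(x', fs') \<in> P" "(y', gs') \<in> P" using peq_path e1 e2 assms by metis+
  show P: "(x, fs @ gs) \<in> P" using assms by (auto simp: paths_def chain_append)
  have P'': "(x', fs' @ gs') \<in> P" using assms P' s t by (auto simp: paths_def chain_append)
  have "p (x, fs @ gs) = p (x, fs @ gs')" using peq_ctx[OF e2, of x fs "[]"] P assms by simp
  also have "(x, fs @ gs') \<in> P" using assms P' s by (auto simp: paths_def chain_append)
  then have "p (x, fs @ gs') = p (x, fs' @ gs')" using peq_ctx[OF e1, of x "[]" gs'] by simp
  also have "... = p (x', fs' @ gs')" using peq_base[OF P'', of x] s P by (auto simp: paths_def)
  finally show "Comp K (p (y, gs)) (p (x, fs)) = p (x, fs @ gs)"
    by (simp add: quot_cat_def Let_def 1 2)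
qed

lemma K_category: "category K"
proof
  fix f assume "f \<in> Arr K"
  then obtain x fs where f: "f = p (x, fs)" "(x, fs) \<in> P" by (auto elim: K_arrE)
  obtain y where y: "y \<in> Obj S" "e (q x) fs = q y" using path_end[OF f(2)] by auto
  have x: "x \<in> Obj S" "(x, []) \<in> P" "(y, []) \<in> P" using f y by (auto simp: paths_def)
  show "Dom K f \<in> Obj K" using f by (auto simp: K_dom K_obj paths_def)
  show "Cod K f \<in> Obj K" using f y by (auto simp: K_cod K_obj)
  show "Comp K f (Id K (Dom K f)) = f"
    using f K_comp[of x "[]" x fs] x by (simp add: K_id K_dom)
  show "Comp K (Id K (Cod K f)) f = f"
    using f K_comp[of x fs y "[]"] x y by (simp add: K_id K_cod)
next
  fix X assume "X \<in> Obj K"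
  then obtain x where x: "X = q x" "x \<in> Obj S" by (auto simp: K_obj)
  then have "(x, []) \<in> P" by (auto simp: paths_def)
  then show "Id K X \<in> Arr K" "Dom K (Id K X) = X" "Cod K (Id K X) = X"
    using x by (auto simp: K_id K_arr K_dom K_cod)
next
  fix f g assume "f \<in> Arr K" "g \<in> Arr K" and c: "Cod K f = Dom K g"
  then obtain x fs y gs where f: "f = p (x, fs)" "(x, fs) \<in> P" and g: "g = p (y, gs)" "(y, gs) \<in> P"
    by (auto elim!: K_arrE)
  have eq: "e (q x) fs = q y" using c f g by (simp add: K_dom K_cod)
  show "Comp K g f \<in> Arr K" "Dom K (Comp K g f) = Dom K f" "Cod K (Comp K g f) = Cod K g"
    using K_comp[OF f(2) g(2) eq] f g eq by (auto simp: K_arr K_dom K_cod chain_end_append)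
  fix h assume "h \<in> Arr K" and d: "Cod K g = Dom K h"
  then obtain z hs where h: "h = p (z, hs)" "(z, hs) \<in> P" by (auto elim!: K_arrE)
  have eq2: "e (q y) gs = q z" using d h g by (simp add: K_dom K_cod)
  show "Comp K h (Comp K g f) = Comp K (Comp K h g) f"
    using K_comp[OF f(2) g(2) eq] K_comp[OF g(2) h(2) eq2] f g h eq eq2
       K_comp[of x "fs @ gs" z hs] K_comp[of x fs y "gs @ hs"] by (simp add: chain_end_append)
qed

lemma single_path: "f \<in> Arr S \<Longrightarrow> (Dom S f, [f]) \<in> P"
  by (simp add: paths_def dom_obj)

lemma quot_functor: "cat_functor S K (quot_ftr S R Q)"
proof (intro cat_functor.intro cat_functor_axioms.intro K_category)
  show "category S" by unfold_locales
  fix x assume x: "x \<in> Obj S"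
  show "ob (quot_ftr S R Q) x \<in> Obj K" using x by (simp add: quot_ftr_def K_obj)
  have "p (x, [] @ [Id S x] @ []) = p (x, [] @ [] @ [])"
    by (rule peq_elem) (use x in \<open>auto simp: elem_rel_def paths_def id_arr dom_id\<close>)
  then show "ar (quot_ftr S R Q) (Id S x) = Id K (ob (quot_ftr S R Q) x)"
    using x by (simp add: quot_ftr_def K_id dom_id)
next
  fix f assume f: "f \<in> Arr S"
  show "ar (quot_ftr S R Q) f \<in> Arr K" "Dom K (ar (quot_ftr S R Q) f) = ob (quot_ftr S R Q) (Dom S f)"
   "Cod K (ar (quot_ftr S R Q) f) = ob (quot_ftr S R Q) (Cod S f)"
    using single_path[OF f] by (auto simp: quot_ftr_def K_arr K_dom K_cod)
  fix g assume g: "g \<in> Arr S" "Cod S f = Dom S g"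
  have "(Dom S f, [] @ [f,g] @ []) \<in> P" using f g by (auto simp: paths_def dom_obj)
  then have "p (Dom S f, [] @ [f,g] @ []) = p (Dom S f, [] @ [Comp S g f] @ [])"
    by (rule peq_elem) (use f g in \<open>auto simp: elem_rel_def\<close>)
  then show "ar (quot_ftr S R Q) (Comp S g f) = Comp K (ar (quot_ftr S R Q) g) (ar (quot_ftr S R Q) f)"
    using K_comp[OF single_path[OF f] single_path[OF g(1)]] f g by (simp add: quot_ftr_def dom_comp)
qed

lemma quot_ident: "(x, y) \<in> R \<Longrightarrow> ob (quot_ftr S R Q) x = ob (quot_ftr S R Q) y"
  "(f, g) \<in> Q \<Longrightarrow> ar (quot_ftr S R Q) f = ar (quot_ftr S R Q) g"
proof -
  show "(x, y) \<in> R \<Longrightarrow> ob (quot_ftr S R Q) x = ob (quot_ftr S R Q) y"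
    by (simp add: quot_ftr_def eq_class_rel)
  assume Q1: "(f, g) \<in> Q"
  then have A: "f \<in> Arr S" "g \<in> Arr S" "q (Dom S f) = q (Dom S g)" using Q Qd by auto
  have "p (Dom S f, [] @ [f] @ []) = p (Dom S f, [] @ [g] @ [])"
    by (rule peq_elem) (use Q1 A single_path in \<open>auto simp: elem_rel_def\<close>)
  also have "... = p (Dom S g, [g])" using peq_base[OF single_path[of g], of "Dom S f"] A dom_obj by simp
  finally show "ar (quot_ftr S R Q) f = ar (quot_ftr S R Q) g" by (simp add: quot_ftr_def)
qed

end

definition lift_ftr :: "('p,'n) cat \<Rightarrow> ('o,'m,'p,'n) ftr \<Rightarrow> ('o set, ('o \<times> 'm list) set, 'p,'n) ftr"
  where "lift_ftr Z F = \<lparr>ob = (\<lambda>X. ob F (some_elem X)),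
    ar = (\<lambda>c. case some_elem c of (x, fs) \<Rightarrow> path_val Z (ar F) (Id Z (ob F x)) fs)\<rparr>"

locale quot_univ = quot S R Q + F: cat_functor S Z F for S :: "('o,'m) cat" and R Q and Z :: "('p,'n) cat" and F +
  assumes FR: "(x, y) \<in> R \<Longrightarrow> ob F x = ob F y" and FQ: "(f, g) \<in> Q \<Longrightarrow> ar F f = ar F g"
begin

lemma F_q: "q x = q y \<Longrightarrow> ob F x = ob F y" by (erule eq_class_invariant) (rule FR)

abbreviation "v \<equiv> path_val Z (ar F)"

lemma v_append: "v a (fs @ gs) = v (v a fs) gs" by (simp add: path_val_def)
lemma v_simps [simp]: "v a [] = a" "v a (f # fs) = v (Comp Z (ar F f) a) fs"  by (auto simp add: path_val_def)

lemma v_type: "\<lbrakk>a \<in> Arr Z; Cod Z a = ob F x; chain S q (q x) fs\<rbrakk> \<Longrightarrow>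
   v a fs \<in> Arr Z \<and> Dom Z (v a fs) = Dom Z a \<and> (\<forall>y. e (q x) fs = q y \<longrightarrow> Cod Z (v a fs) = ob F y)"
proof (induction fs arbitrary: a x)
  case Nil then show ?case by (auto dest: F_q)
next
  case (Cons f fs)
  then have "f \<in> Arr S" "Dom Z (ar F f) = Cod Z a" by (auto dest: F_q simp: F.dom_ar)
  then show ?case using Cons.prems Cons.IH[of "Comp Z (ar F f) a" "Cod S f"]
    by (auto simp: F.target.comp_arr F.target.cod_comp F.target.dom_comp F.ar_in F.cod_ar)
qed

lemma v_elem: assumes "a \<in> Arr Z" "Cod Z a = ob F x" "chain S q (q x) l" "(l, r) \<in> elem_rel S Q"
  shows "v a l = v a r"
proof -
  consider y where "y \<in> Obj S" "l = [Id S y]" "r = []"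
    | f g where "f \<in> Arr S" "g \<in> Arr S" "Cod S f = Dom S g" "l = [f,g]" "r = [Comp S g f]"
    | f g where "(f, g) \<in> Q" "l = [f]" "r = [g]" using assms(4) unfolding elem_rel_def by auto
  then show ?thesis
  proof cases
    case 1 then have "ob F y = ob F x" using assms by (auto simp: dom_id dest: F_q)
    then show ?thesis using 1 assms F.target.id_comp[of a] by (auto simp: F.ar_id)
  next
    case 2 then have "ob F (Dom S f) = ob F x" using assms by (auto simp: dom_id dest: F_q)
    then show ?thesis using 2 assms F.target.comp_assoc[of a "ar F f" "ar F g"]
      by (auto simp: F.ar_comp F.ar_in F.dom_ar F.cod_ar)
  qed (auto simp: FQ)
qed

lemma v_rel: "((x, fs), (y, gs)) \<in> path_rel S R Q \<Longrightarrow> v (Id Z (ob F x)) fs = v (Id Z (ob F y)) gs"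
proof -
  assume a: "((x, fs), (y, gs)) \<in> path_rel S R Q"
  then obtain us vs l r where 1: "fs = us @ l @ vs" "gs = us @ r @ vs"
     "q x = q y" "(l, r) \<in> elem_rel S Q \<or> l = r" and P: "(x, fs) \<in> P" "(y, gs) \<in> P"
    by (auto simp: path_rel_def)
  have xy: "ob F x = ob F y" using 1 F_q by blast
  have us: "(x, us) \<in> P" using P 1 by (auto simp: paths_def chain_append)
  obtain z where z: "e (q x) us = q z" using path_end[OF us] by auto
  have "v (v (Id Z (ob F x)) us) l = v (v (Id Z (ob F x)) us) r"
  proof (cases "l = r")
    case False
    have x: "x \<in> Obj S" using us by (auto simp: paths_def)
    have t: "v (Id Z (ob F x)) us \<in> Arr Z \<and> Cod Z (v (Id Z (ob F x)) us) = ob F z"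
      using v_type[of "Id Z (ob F x)" x us] us x z
      by (auto simp: F.ob_in F.target.id_arr F.target.cod_id paths_def)
    show ?thesis by (rule v_elem[of _ z]) (use t False 1 P z in \<open>auto simp: paths_def chain_append\<close>)
  qed auto
  then show ?thesis using 1 xy by (simp add: v_append)
qed

lemma lift_ob: "ob (lift_ftr Z F) (q x) = ob F x"
  using F_q[OF some_elem_class] by (simp add: lift_ftr_def)

lemma lift_ar: "ar (lift_ftr Z F) (p (x, fs)) = v (Id Z (ob F x)) fs"
proof -
  have "(\<lambda>(x,fs). v (Id Z (ob F x)) fs) (some_elem (p (x, fs))) = (\<lambda>(x,fs). v (Id Z (ob F x)) fs) (x, fs)"
    by (rule eq_class_invariant[OF some_elem_class]) (use v_rel in auto)
  then show ?thesis by (simp add: lift_ftr_def)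
qed

lemma v_shift: "\<lbrakk>a \<in> Arr Z; b \<in> Arr Z; Cod Z a = Dom Z b; Cod Z b = ob F x; chain S q (q x) fs\<rbrakk> \<Longrightarrow>
  v (Comp Z b a) fs = Comp Z (v b fs) a"
proof (induction fs arbitrary: a b x)
  case (Cons f fs)
  then have "f \<in> Arr S" "Dom Z (ar F f) = Cod Z b" by (auto dest: F_q simp: F.dom_ar)
  then show ?case using Cons.prems Cons.IH[of a "Comp Z (ar F f) b" "Cod S f"]
    by (simp add: F.target.comp_arr F.target.cod_comp F.target.dom_comp F.ar_in F.cod_ar
       F.target.comp_assoc)
qed auto

lemma lift_functor: "cat_functor K Z (lift_ftr Z F)"
proof (intro cat_functor.intro cat_functor_axioms.intro K_category)
  show "category Z" by unfold_locales
  fix X assume "X \<in> Obj K" then obtain x where x: "x \<in> Obj S" "X = q x" by (auto simp: K_obj)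
  show "ob (lift_ftr Z F) X \<in> Obj Z" "ar (lift_ftr Z F) (Id K X) = Id Z (ob (lift_ftr Z F) X)"
    using x by (auto simp: lift_ob lift_ar F.ob_in K_id)
next
  fix f assume "f \<in> Arr K" then obtain x fs where f: "f = p (x, fs)" "(x, fs) \<in> P" by (auto elim: K_arrE)
  obtain y where y: "y \<in> Obj S" "e (q x) fs = q y" using path_end[OF f(2)] by auto
  have x: "x \<in> Obj S" using f by (auto simp: paths_def)
  have t: "v (Id Z (ob F x)) fs \<in> Arr Z" "Dom Z (v (Id Z (ob F x)) fs) = ob F x" "Cod Z (v (Id Z (ob F x)) fs) = ob F y"
      using v_type[of "Id Z (ob F x)" x fs] x y f
      by (auto simp: F.ob_in F.target.id_arr F.target.cod_id F.target.dom_id paths_def)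
  show "ar (lift_ftr Z F) f \<in> Arr Z" "Dom Z (ar (lift_ftr Z F) f) = ob (lift_ftr Z F) (Dom K f)"
    "Cod Z (ar (lift_ftr Z F) f) = ob (lift_ftr Z F) (Cod K f)"
    using t f y by (simp_all add: lift_ar lift_ob K_dom K_cod)
  fix g assume "g \<in> Arr K" and c: "Cod K f = Dom K g"
  then obtain y' gs where g: "g = p (y', gs)" "(y', gs) \<in> P" by (auto elim: K_arrE)
  have y': "y' \<in> Obj S" using g by (auto simp: paths_def)
  have qy: "q y = q y'" using c f g y by (simp add: K_dom K_cod)
  have t3: "Cod Z (v (Id Z (ob F x)) fs) = ob F y'" using F_q[OF qy] t by simp
  have "v (v (Id Z (ob F x)) fs) gs = v (Comp Z (Id Z (ob F y')) (v (Id Z (ob F x)) fs)) gs"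
    using F.target.id_comp[OF t(1)] t3 by simp
  also have "... = Comp Z (v (Id Z (ob F y')) gs) (v (Id Z (ob F x)) fs)"
    by (rule v_shift[of _ _ y']) (use t(1) t3 F.target.id_arr[OF F.ob_in[OF y']] g
      F.target.dom_id[OF F.ob_in[OF y']] F.target.cod_id[OF F.ob_in[OF y']] in \<open>simp_all add: paths_def\<close>)
  finally show "ar (lift_ftr Z F) (Comp K g f) = Comp Z (ar (lift_ftr Z F) g) (ar (lift_ftr Z F) f)"
    using K_comp[of x fs y' gs] f g y qy by (simp add: lift_ar v_append)
qed

lemma lift_quot: "eq_ftr_on S (comp_ftr (lift_ftr Z F) (quot_ftr S R Q)) F"
proof -
  have "Comp Z (ar F f) (Id Z (ob F (Dom S f))) = ar F f" if "f \<in> Arr S" for f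
    using F.target.comp_id[of "ar F f"] that by (simp add: F.ar_in F.dom_ar)
  then show ?thesis by (simp add: eq_ftr_on_def comp_ftr_def quot_ftr_def lift_ob lift_ar)
qed

lemma lift_unique:
  assumes "cat_functor K Z M" "eq_ftr_on S (comp_ftr M (quot_ftr S R Q)) F"
  shows "eq_ftr_on K M (lift_ftr Z F)"
proof -
  interpret M: cat_functor K Z M by fact
  have o: "ob M (q x) = ob F x" if "x \<in> Obj S" for x
    using assms(2) that by (simp add: eq_ftr_on_def comp_ftr_def quot_ftr_def)
  have a: "ar M (p (Dom S f, [f])) = ar F f" if "f \<in> Arr S" for f
    using assms(2) that by (simp add: eq_ftr_on_def comp_ftr_def quot_ftr_def)
  have "(x, fs) \<in> P \<Longrightarrow> ar M (p (x, fs)) = v (Id Z (ob F x)) fs" for x fs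
  proof (induction fs rule: rev_induct)
    case Nil
    then show ?case using M.ar_id[of "q x"] by (simp add: paths_def K_obj K_id o)
  next
    case (snoc f fs)
    then have P: "(x, fs) \<in> P" "f \<in> Arr S" "e (q x) fs = q (Dom S f)" by (auto simp: paths_def chain_append)
    note K_comp[OF P(1) single_path[OF P(2)] P(3)]
    then have "ar M (p (x, fs @ [f])) = ar M (Comp K (p (Dom S f, [f])) (p (x, fs)))" by simp
    also have "... = Comp Z (ar M (p (Dom S f, [f]))) (ar M (p (x, fs)))"
      by (rule M.ar_comp) (use P single_path in \<open>auto simp: K_arr K_cod K_dom\<close>)
    finally show ?case using snoc.IH P by (simp add: a v_append)
  qed
  then show ?thesis unfolding eq_ftr_on_def by (auto simp: K_obj K_arr o lift_ob lift_ar)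
qed

end


section \<open>Groupoids and elementary functors\<close>

locale groupoid = category C for C :: "('o,'m) cat" +
  assumes inverse: "f \<in> Arr C \<Longrightarrow> \<exists>g\<in>Arr C. Dom C g = Cod C f \<and> Cod C g = Dom C f \<and>
    Comp C g f = Id C (Dom C f) \<and> Comp C f g = Id C (Cod C f)"

lemma one_groupoid: "groupoid one_cat"
  by unfold_locales (auto simp: one_cat_def)

lemma to_one_functor: "category C \<Longrightarrow> cat_functor C one_cat to_one"
  using one_groupoid unfolding groupoid_def
  by (auto intro!: cat_functor.intro cat_functor_axioms.intro) (auto simp: one_cat_def to_one_def)

lemma indiscrete_groupoid: "groupoid (indiscrete X)"
  by unfold_locales (auto simp: indiscrete_def)

lemma discrete_groupoid: "groupoid (discrete X)"
  by unfold_locales (auto simp: discrete_def)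

lemma prod_category: assumes "category C" "category D" shows "category (prod_cat C D)"
proof -
  interpret C: category C by fact
  interpret D: category D by fact
  show ?thesis
    by unfold_locales (auto simp: prod_cat_def C.dom_obj C.cod_obj C.id_arr C.dom_id C.cod_id C.comp_arr
      C.dom_comp C.cod_comp C.comp_id C.id_comp C.comp_assoc
      D.dom_obj D.cod_obj D.id_arr D.dom_id D.cod_id D.comp_arr
      D.dom_comp D.cod_comp D.comp_id D.id_comp D.comp_assoc)
qed

lemma prod_groupoid: assumes "groupoid C" "groupoid D" shows "groupoid (prod_cat C D)"
proof -
  interpret C: groupoid C by fact
  interpret D: groupoid D by fact
  interpret P: category "prod_cat C D" by (rule prod_category) unfold_locales
  show ?thesis
  proof
    fix f assume "f \<in> Arr (prod_cat C D)"
    then obtain a b where f: "f = (a, b)" "a \<in> Arr C" "b \<in> Arr D" by (auto simp: prod_cat_def)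
    then obtain a' b' where "a' \<in> Arr C" "b' \<in> Arr D" "Dom C a' = Cod C a \<and> Cod C a' = Dom C a \<and>
    Comp C a' a = Id C (Dom C a) \<and> Comp C a a' = Id C (Cod C a)" "Dom D b' = Cod D b \<and> Cod D b' = Dom D b \<and>
    Comp D b' b = Id D (Dom D b) \<and> Comp D b b' = Id D (Cod D b)" using C.inverse D.inverse by meson
    then show "\<exists>g\<in>Arr (prod_cat C D).
            Dom (prod_cat C D) g = Cod (prod_cat C D) f \<and>
            Cod (prod_cat C D) g = Dom (prod_cat C D) f \<and>
            Comp (prod_cat C D) g f = Id (prod_cat C D) (Dom (prod_cat C D) f) \<and>
            Comp (prod_cat C D) f g = Id (prod_cat C D) (Cod (prod_cat C D) f)"
      by (intro bexI[of _ "(a', b')"]) (auto simp: prod_cat_def f)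
  qed
qed

lemma coprod_category: assumes "\<And>i. i \<in> I \<Longrightarrow> category (C i)" shows "category (coprod_cat I C)"
  by unfold_locales (insert assms, auto simp: coprod_cat_def category_def)

lemma coprod_groupoid: assumes "\<And>i. i \<in> I \<Longrightarrow> groupoid (C i)" shows "groupoid (coprod_cat I C)"
proof (intro groupoid.intro groupoid_axioms.intro)
  show "category (coprod_cat I C)" using assms by (intro coprod_category) (simp add: groupoid_def)
  fix f assume "f \<in> Arr (coprod_cat I C)"
  then obtain i a where f: "f = (i, a)" "i \<in> I" "a \<in> Arr (C i)" by (auto simp: coprod_cat_def)
  obtain b where "b \<in> Arr (C i)" "Dom (C i) b = Cod (C i) a \<and> Cod (C i) b = Dom (C i) a \<and>
    Comp (C i) b a = Id (C i) (Dom (C i) a) \<and> Comp (C i) a b = Id (C i) (Cod (C i) a)"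
    using groupoid.inverse[OF assms[OF f(2)] f(3)] by auto
  then show "\<exists>g\<in>Arr (coprod_cat I C). Dom (coprod_cat I C) g = Cod (coprod_cat I C) f \<and>
     Cod (coprod_cat I C) g = Dom (coprod_cat I C) f \<and>
    Comp (coprod_cat I C) g f = Id (coprod_cat I C) (Dom (coprod_cat I C) f) \<and>
    Comp (coprod_cat I C) f g = Id (coprod_cat I C) (Cod (coprod_cat I C) f)"
    by (intro bexI[of _ "(i, b)"]) (auto simp: coprod_cat_def f)
qed

lemma sum_category: assumes "category C" "category D" shows "category (sum_cat C D)"
proof -
  interpret C: category C by fact
  interpret D: category D by fact
  show ?thesis
    by unfold_locales (auto simp: sum_cat_def C.dom_obj C.cod_obj C.id_arr C.dom_id C.cod_id C.comp_arr
      C.dom_comp C.cod_comp C.comp_id C.id_comp C.comp_assoc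
      D.dom_obj D.cod_obj D.id_arr D.dom_id D.cod_id D.comp_arr
      D.dom_comp D.cod_comp D.comp_id D.id_comp D.comp_assoc)
qed

lemma sum_groupoid: assumes "groupoid C" "groupoid D" shows "groupoid (sum_cat C D)"
proof -
  interpret C: groupoid C by fact
  interpret D: groupoid D by fact
  interpret P: category "sum_cat C D" by (rule sum_category) unfold_locales
  show ?thesis
  proof
    fix f assume "f \<in> Arr (sum_cat C D)"
    then consider a where "f = Inl a" "a \<in> Arr C" | a where "f = Inr a" "a \<in> Arr D" by (auto simp: sum_cat_def)
    then show "\<exists>g\<in>Arr (sum_cat C D).
            Dom (sum_cat C D) g = Cod (sum_cat C D) f \<and>
            Cod (sum_cat C D) g = Dom (sum_cat C D) f \<and>
            Comp (sum_cat C D) g f = Id (sum_cat C D) (Dom (sum_cat C D) f) \<and>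
            Comp (sum_cat C D) f g = Id (sum_cat C D) (Cod (sum_cat C D) f)"
    proof cases
      case 1
      then obtain b where "b \<in> Arr C" "Dom C b = Cod C a \<and> Cod C b = Dom C a \<and>
        Comp C b a = Id C (Dom C a) \<and> Comp C a b = Id C (Cod C a)" using C.inverse by meson
      then show ?thesis using 1 by (intro bexI[of _ "Inl b"]) (auto simp: sum_cat_def)
    next
      case 2
      then obtain b where "b \<in> Arr D" "Dom D b = Cod D a \<and> Cod D b = Dom D a \<and>
        Comp D b a = Id D (Dom D a) \<and> Comp D a b = Id D (Cod D a)" using D.inverse by meson
      then show ?thesis using 2 by (intro bexI[of _ "Inr b"]) (auto simp: sum_cat_def)
    qed
  qed
qed

lemma comp_functor: assumes "cat_functor C D F" "cat_functor D E G" shows "cat_functor C E (comp_ftr G F)"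
proof -
  interpret F: cat_functor C D F by fact
  interpret G: cat_functor D E G by fact
  show ?thesis by unfold_locales (auto simp: comp_ftr_def F.ob_in G.ob_in F.ar_in G.ar_in F.dom_ar G.dom_ar
    F.cod_ar G.cod_ar F.ar_id G.ar_id F.ar_comp G.ar_comp)
qed

lemma inl_functor: "category C \<Longrightarrow> category D \<Longrightarrow> cat_functor C (sum_cat C D) \<lparr>ob = Inl, ar = Inl\<rparr>"
  by (intro cat_functor.intro cat_functor_axioms.intro sum_category) (auto simp: sum_cat_def)
lemma inr_functor: "category C \<Longrightarrow> category D \<Longrightarrow> cat_functor D (sum_cat C D) \<lparr>ob = Inr, ar = Inr\<rparr>"
  by (intro cat_functor.intro cat_functor_axioms.intro sum_category) (auto simp: sum_cat_def)

lemma case_functor: assumes "cat_functor C Z F" "cat_functor D Z G"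
  shows "cat_functor (sum_cat C D) Z \<lparr>ob = case_sum (ob F) (ob G), ar = case_sum (ar F) (ar G)\<rparr>"
proof -
  interpret F: cat_functor C Z F by fact
  interpret G: cat_functor D Z G by fact
  show ?thesis by (intro cat_functor.intro cat_functor_axioms.intro sum_category)
    (unfold_locales, auto simp: sum_cat_def F.ob_in G.ob_in F.ar_in G.ar_in F.dom_ar G.dom_ar
    F.cod_ar G.cod_ar F.ar_id G.ar_id F.ar_comp G.ar_comp)
qed

lemma coprod_in_functor: "\<lbrakk>\<And>i. i \<in> I \<Longrightarrow> category (C i); i \<in> I\<rbrakk> \<Longrightarrow>
  cat_functor (C i) (coprod_cat I C) \<lparr>ob = Pair i, ar = Pair i\<rparr>"
  by (intro cat_functor.intro cat_functor_axioms.intro coprod_category) (auto simp: coprod_cat_def)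

lemma coprod_functor: assumes "\<And>i. i \<in> I \<Longrightarrow> cat_functor (C i) Z \<lparr>ob = \<lambda>x. ob F (i, x), ar = \<lambda>x. ar F (i, x)\<rparr>"
  "category Z"
  shows "cat_functor (coprod_cat I C) Z F"
proof (intro cat_functor.intro cat_functor_axioms.intro coprod_category)
  show "category (C i)" if "i \<in> I" for i using assms(1)[OF that] by (simp add: cat_functor_def)
qed (insert assms, auto simp: coprod_cat_def cat_functor_def cat_functor_axioms_def)

lemma (in quot) quot_groupoid: assumes "groupoid S" shows "groupoid K"
proof (intro groupoid.intro groupoid_axioms.intro K_category)
  interpret K: category K by (rule K_category)
  interpret q: cat_functor S K "quot_ftr S R Q" by (rule quot_functor)
  have "(x, fs) \<in> P \<Longrightarrow> \<exists>g\<in>Arr K. Dom K g = Cod K (p (x, fs)) \<and> Cod K g = Dom K (p (x, fs)) \<and>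
    Comp K g (p (x, fs)) = Id K (Dom K (p (x, fs))) \<and> Comp K (p (x, fs)) g = Id K (Cod K (p (x, fs)))" for x fs
  proof (induction fs rule: rev_induct)
    case Nil
    then have x: "x \<in> Obj S" by (auto simp: paths_def)
    show ?case by (rule bexI[of _ "p (x, [])"]) (use x Nil K_comp[of x "[]" x "[]"] in \<open>auto simp: K_dom K_cod K_id K_arr\<close>)
  next
    case (snoc f fs)
    then have P: "(x, fs) \<in> P" "f \<in> Arr S" "e (q x) fs = q (Dom S f)" by (auto simp: paths_def chain_append)
    define a where "a = p (x, fs)"
    define b where "b = p (Dom S f, [f])"
    have ab: "p (x, fs @ [f]) = Comp K b a" "a \<in> Arr K" "b \<in> Arr K" "Cod K a = Dom K b"
      using K_comp[OF P(1) single_path[OF P(2)] P(3)] P single_path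
      by (auto simp: a_def b_def K_arr K_cod K_dom)
    obtain g where g: "g \<in> Arr K" "Dom K g = Cod K a" "Cod K g = Dom K a"
      "Comp K g a = Id K (Dom K a)" "Comp K a g = Id K (Cod K a)" using snoc P by (auto simp: a_def)
    obtain f' where f': "f' \<in> Arr S" "Dom S f' = Cod S f" "Cod S f' = Dom S f"
      "Comp S f' f = Id S (Dom S f)" "Comp S f f' = Id S (Cod S f)" using groupoid.inverse[OF assms P(2)] by auto
    define h where "h = ar (quot_ftr S R Q) f'"
    have b: "b = ar (quot_ftr S R Q) f" by (simp add: b_def quot_ftr_def)
    have h: "h \<in> Arr K" "Dom K h = Cod K b" "Cod K h = Dom K b"
      "Comp K h b = Id K (Dom K b)" "Comp K b h = Id K (Cod K b)"
      unfolding h_def b using f' P q.ar_comp[of f f'] q.ar_comp[of f' f]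
      by (simp_all add: q.ar_in q.dom_ar q.cod_ar dom_obj cod_obj q.ar_id)
    have 1: "Comp K (Comp K g h) (Comp K b a) = Comp K g (Comp K (Comp K h b) a)"
      using ab g h K.comp_assoc[of "Comp K b a" h g] K.comp_assoc[of a b h]
      by (simp only: K.comp_arr K.dom_comp K.cod_comp)
    have 2: "Comp K (Comp K b a) (Comp K g h) = Comp K b (Comp K (Comp K a g) h)"
      using ab g h K.comp_assoc[of "Comp K g h" a b] K.comp_assoc[of h g a]
      by (simp only: K.comp_arr K.dom_comp K.cod_comp)
    show ?case unfolding ab(1)
      by (rule bexI[of _ "Comp K g h"])
       (use ab g h 1 2 K.id_comp[of a] K.id_comp[of h] in \<open>simp_all add: K.comp_arr K.dom_comp K.cod_comp\<close>)
  qed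
  then show "\<exists>g\<in>Arr K. Dom K g = Cod K f \<and> Cod K g = Dom K f \<and>
    Comp K g f = Id K (Dom K f) \<and> Comp K f g = Id K (Cod K f)" if "f \<in> Arr K" for f
    using that by (auto elim!: K_arrE)
qed


section \<open>The universal property of the pushout\<close>

lemma sum_carr: "Obj (sum_cat D E) = Obj D <+> Obj E" "Arr (sum_cat D E) = Arr D <+> Arr E"
  by (simp_all add: sum_cat_def)

lemma ball_Plus: "(\<forall>x\<in>A <+> B. P x) \<longleftrightarrow> (\<forall>x\<in>A. P (Inl x)) \<and> (\<forall>x\<in>B. P (Inr x))"
  by auto

locale pushout_square = F: cat_functor C D F + G: cat_functor C E G for C :: "('o,'m) cat" and D :: "('p,'n) cat" and E :: "('q,'r) cat" and F G
begin

sublocale quot "sum_cat D E" "po_ob_rel C F G" "po_ar_rel C F G"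
proof (intro quot.intro quot_axioms.intro)
  show "category (sum_cat D E)" by (rule sum_category) unfold_locales
  show "po_ob_rel C F G \<subseteq> Obj (sum_cat D E) \<times> Obj (sum_cat D E)"
    "po_ar_rel C F G \<subseteq> Arr (sum_cat D E) \<times> Arr (sum_cat D E)"
    by (auto simp: po_ob_rel_def po_ar_rel_def sum_cat_def F.ob_in G.ob_in F.ar_in G.ar_in)
  fix f g assume "(f, g) \<in> po_ar_rel C F G"
  then obtain c where c: "c \<in> Arr C" "f = Inl (ar F c)" "g = Inr (ar G c)" by (auto simp: po_ar_rel_def)
  show "eq_class (po_ob_rel C F G) (Dom (sum_cat D E) f) = eq_class (po_ob_rel C F G) (Dom (sum_cat D E) g)"
    "eq_class (po_ob_rel C F G) (Cod (sum_cat D E) f) = eq_class (po_ob_rel C F G) (Cod (sum_cat D E) g)"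
    using c by (auto intro!: eq_class_rel simp: po_ob_rel_def sum_cat_def F.dom_ar F.cod_ar G.dom_ar G.cod_ar
       F.source.dom_obj F.source.cod_obj)
qed

abbreviation "Po \<equiv> pushout C D E F G"
abbreviation "inD \<equiv> pushout_left C D E F G"
abbreviation "inE \<equiv> pushout_right C D E F G"

lemma Po_category: "category Po" using K_category by (simp add: pushout_def)
lemma inD_functor: "cat_functor D Po inD" unfolding pushout_def pushout_left_def
  by (rule comp_functor[OF inl_functor quot_functor]) unfold_locales
lemma inE_functor: "cat_functor E Po inE" unfolding pushout_def pushout_right_def
  by (rule comp_functor[OF inr_functor quot_functor]) unfold_locales
lemma Po_commute: "eq_ftr_on C (comp_ftr inD F) (comp_ftr inE G)"
proof -
  have "(Inl (ob F x), Inr (ob G x)) \<in> po_ob_rel C F G" if "x \<in> Obj C" for x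
    using that by (auto simp: po_ob_rel_def)
  moreover have "(Inl (ar F x), Inr (ar G x)) \<in> po_ar_rel C F G" if "x \<in> Arr C" for x
    using that by (auto simp: po_ar_rel_def)
  ultimately show ?thesis using quot_ident
    unfolding eq_ftr_on_def by (simp add: pushout_left_def pushout_right_def comp_ftr_def)
qed
lemma Po_obj: "Obj Po = ob inD ` Obj D \<union> ob inE ` Obj E"
  unfolding pushout_def K_obj pushout_left_def pushout_right_def
  by (auto simp: sum_cat_def comp_ftr_def quot_ftr_def)
lemma Po_groupoid: "groupoid D \<Longrightarrow> groupoid E \<Longrightarrow> groupoid Po"
  unfolding pushout_def using quot_groupoid sum_groupoid by blast

lemma Po_univ:
  assumes "cat_functor D Z H" "cat_functor E Z J" "eq_ftr_on C (comp_ftr H F) (comp_ftr J G)"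
  shows "\<exists>M. cat_functor Po Z M \<and> eq_ftr_on D (comp_ftr M inD) H \<and> eq_ftr_on E (comp_ftr M inE) J \<and>
     (\<forall>M'. cat_functor Po Z M' \<and> eq_ftr_on D (comp_ftr M' inD) H \<and> eq_ftr_on E (comp_ftr M' inE) J
        \<longrightarrow> eq_ftr_on Po M' M)"
proof -
  let ?F = "\<lparr>ob = case_sum (ob H) (ob J), ar = case_sum (ar H) (ar J)\<rparr>"
  interpret u: quot_univ "sum_cat D E" "po_ob_rel C F G" "po_ar_rel C F G" Z ?F
  proof (intro quot_univ.intro quot_univ_axioms.intro case_functor assms)
    show "quot (sum_cat D E) (po_ob_rel C F G) (po_ar_rel C F G)" by unfold_locales
  qed (insert assms(3), auto simp: po_ob_rel_def po_ar_rel_def eq_ftr_on_def comp_ftr_def)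
  have 1: "eq_ftr_on D (comp_ftr M inD) H \<and> eq_ftr_on E (comp_ftr M inE) J \<longleftrightarrow>
     eq_ftr_on (sum_cat D E) (comp_ftr M (quot_ftr (sum_cat D E) (po_ob_rel C F G) (po_ar_rel C F G))) ?F" for M
    by (auto simp: eq_ftr_on_def comp_ftr_def sum_carr pushout_left_def pushout_right_def ball_Plus)
  show ?thesis using u.lift_functor u.lift_quot u.lift_unique unfolding pushout_def 1 conj_assoc[symmetric]
    by (auto simp: pushout_def[symmetric] 1)
qed

end

locale image_iso = category C for C :: "('o,'m) cat" +
  fixes \<phi> :: "'o \<Rightarrow> 'p" and \<psi> :: "'m \<Rightarrow> 'n"
  assumes i1: "inj_on \<phi> (Obj C)" and i2: "inj_on \<psi> (Arr C)"
begin

abbreviation "I \<equiv> image_cat \<phi> \<psi> C"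
abbreviation "co \<equiv> \<lparr>ob = \<phi>, ar = \<psi>\<rparr>"
definition "de = \<lparr>ob = inv_into (Obj C) \<phi>, ar = inv_into (Arr C) \<psi>\<rparr>"

lemma inv1: "x \<in> Obj C \<Longrightarrow> inv_into (Obj C) \<phi> (\<phi> x) = x"  using i1 by auto
lemma inv2: "x \<in> Arr C \<Longrightarrow> inv_into (Arr C) \<psi> (\<psi> x) = x"  using i2 by auto

lemma I_category: "category I"
  by unfold_locales
   (auto simp: image_cat_def Let_def inv1 inv2 dom_obj cod_obj id_arr dom_id cod_id comp_arr dom_comp cod_comp
      comp_id id_comp comp_assoc inj_on_eq_iff[OF i1])

lemma co_functor: "cat_functor C I co"
  by (intro cat_functor.intro I_category cat_functor_axioms.intro)
   (unfold_locales, auto simp: image_cat_def Let_def inv1 inv2 dom_obj cod_obj id_arr)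
lemma de_functor: "cat_functor I C de"
  by (intro cat_functor.intro I_category cat_functor_axioms.intro)
   (unfold_locales, auto simp: de_def image_cat_def Let_def inv1 inv2 dom_obj cod_obj id_arr comp_arr
      inj_on_eq_iff[OF i1])
lemma de_co: "x \<in> Obj C \<Longrightarrow> ob de (ob co x) = x" "f \<in> Arr C \<Longrightarrow> ar de (ar co f) = f"
  by (auto simp: de_def inv1 inv2)
lemma I_carr: "Obj I = ob co ` Obj C" "Arr I = ar co ` Arr C"
  by (auto simp: image_cat_def Let_def)
lemma I_groupoid: assumes "groupoid C" shows "groupoid I"
proof (intro groupoid.intro groupoid_axioms.intro I_category)
  fix f assume "f \<in> Arr I"
  then obtain a where a: "a \<in> Arr C" "f = \<psi> a" by (auto simp: I_carr)
  then obtain b where b: "b \<in> Arr C" "Dom C b = Cod C a \<and> Cod C b = Dom C a \<and>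
        Comp C b a = Id C (Dom C a) \<and> Comp C a b = Id C (Cod C a)" using groupoid.inverse[OF assms] by meson
  show "\<exists>g\<in>Arr I. Dom I g = Cod I f \<and> Cod I g = Dom I f \<and>
    Comp I g f = Id I (Dom I f) \<and> Comp I f g = Id I (Cod I f)"
    by (rule bexI[of _ "\<psi> b"]) (use a b in \<open>auto simp: image_cat_def Let_def inv1 inv2 dom_obj cod_obj\<close>)
qed

end


section \<open>The recursion for the Catalan groupoids; \<open>pi_A n\<close> is a group\<close>

lemma coprod_cong: "(\<And>i. i \<in> I \<Longrightarrow> C i = D i) \<Longrightarrow> coprod_cat I C = coprod_cat I D"
proof -
  assume a: "\<And>i. i \<in> I \<Longrightarrow> C i = D i"
  then have "restrict C I = restrict D I" by (rule restrict_ext)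
  moreover have "Sigma I (\<lambda>i. Obj (C i)) = Sigma I (\<lambda>i. Obj (D i))" "Sigma I (\<lambda>i. Arr (C i)) = Sigma I (\<lambda>i. Arr (D i))"
    using a by auto
  ultimately show ?thesis by (simp add: coprod_cat_def)
qed

lemma pair_cong: "(\<And>m. m < n \<Longrightarrow> 1 \<le> m \<Longrightarrow> A m = B m) \<Longrightarrow> pair_cat n A = pair_cat n B"
  unfolding pair_cat_def by (rule coprod_cong) (auto simp: pairs_def)
lemma triple_cong: "(\<And>m. m < n \<Longrightarrow> 1 \<le> m \<Longrightarrow> A m = B m) \<Longrightarrow> triple_cat J n A X = triple_cat J n B X"
  unfolding triple_cat_def by (rule coprod_cong) (auto simp: triples_def)

lemma triple_carr: "((i,j,k),(x,y,z,t)) \<in> Obj (triple_cat J n A X) \<longleftrightarrow>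
   (i,j,k) \<in> triples J n \<and> x \<in> Obj (A i) \<and> y \<in> Obj (A j) \<and> z \<in> Obj (A k) \<and> t \<in> Obj X"
  "((i,j,k),(f,g,h,u)) \<in> Arr (triple_cat J n A X) \<longleftrightarrow>
   (i,j,k) \<in> triples J n \<and> f \<in> Arr (A i) \<and> g \<in> Arr (A j) \<and> h \<in> Arr (A k) \<and> u \<in> Arr X"
  by (auto simp: triple_cat_def coprod_cat_def prod_cat_def)

lemma pair_carr: "((i,j),(x,y)) \<in> Obj (pair_cat n A) \<longleftrightarrow>
   (i,j) \<in> pairs n \<and> x \<in> Obj (A i) \<and> y \<in> Obj (A j)"
  "((i,j),(f,g)) \<in> Arr (pair_cat n A) \<longleftrightarrow>
   (i,j) \<in> pairs n \<and> f \<in> Arr (A i) \<and> g \<in> Arr (A j)"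
  by (auto simp: pair_cat_def coprod_cat_def prod_cat_def)

lemma triple_ops: "(i,j,k) \<in> triples J n \<Longrightarrow> Dom (triple_cat J n A X) ((i,j,k),(f,g,h,u)) =
   ((i,j,k), (Dom (A i) f, Dom (A j) g, Dom (A k) h, Dom X u))"
 "(i,j,k) \<in> triples J n \<Longrightarrow> Cod (triple_cat J n A X) ((i,j,k),(f,g,h,u)) =
   ((i,j,k), (Cod (A i) f, Cod (A j) g, Cod (A k) h, Cod X u))"
 "(i,j,k) \<in> triples J n \<Longrightarrow> Id (triple_cat J n A X) ((i,j,k),(x,y,z,t)) =
   ((i,j,k), (Id (A i) x, Id (A j) y, Id (A k) z, Id X t))"
 "(i,j,k) \<in> triples J n \<Longrightarrow> Comp (triple_cat J n A X) ((i,j,k),(f',g',h',u')) (c,(f,g,h,u)) =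
   ((i,j,k), (Comp (A i) f' f, Comp (A j) g' g, Comp (A k) h' h, Comp X u' u))"
  by (auto simp: triple_cat_def coprod_cat_def prod_cat_def)

lemma pair_ops: "(i,j) \<in> pairs n \<Longrightarrow> Dom (pair_cat n A) ((i,j),(f,g)) =
   ((i,j), (Dom (A i) f, Dom (A j) g))"
 "(i,j) \<in> pairs n \<Longrightarrow> Cod (pair_cat n A) ((i,j),(f,g)) =
   ((i,j), (Cod (A i) f, Cod (A j) g))"
 "(i,j) \<in> pairs n \<Longrightarrow> Id (pair_cat n A) ((i,j),(x,y)) =
   ((i,j), (Id (A i) x, Id (A j) y))"
 "(i,j) \<in> pairs n \<Longrightarrow> Comp (pair_cat n A) ((i,j),(f',g')) (c,(f,g)) =
   ((i,j), (Comp (A i) f' f, Comp (A j) g' g))"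
  by (auto simp: pair_cat_def coprod_cat_def prod_cat_def)

lemma po_rel_image: "po_ob_rel C F G = (\<lambda>x. (Inl (ob F x), Inr (ob G x))) ` Obj C"
  "po_ar_rel C F G = (\<lambda>x. (Inl (ar F x), Inr (ar G x))) ` Arr C"
  by (auto simp: po_ob_rel_def po_ar_rel_def)

lemma next_stage_cong:
  assumes "\<And>m. m < n \<Longrightarrow> 1 \<le> m \<Longrightarrow> S m = S' m"
  shows "next_stage J n S = next_stage J n S'"
proof -
  let ?A = "\<lambda>m. st_cat (S m)" and ?A' = "\<lambda>m. st_cat (S' m)"
  have t: "triple_cat J n ?A X = triple_cat J n ?A' X" for X
    by (rule triple_cong) (simp add: assms)
  have p: "pair_cat n ?A = pair_cat n ?A'" by (rule pair_cong) (simp add: assms)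
  have o: "x \<in> Obj (triple_cat J n ?A' X) \<Longrightarrow> ob (W_ftr (U_of S)) x = ob (W_ftr (U_of S')) x" for x X
  proof -
    obtain i j k a b c t where "x = ((i,j,k),(a,b,c,t))" by (metis prod.exhaust)
    then show "x \<in> Obj (triple_cat J n ?A' X) \<Longrightarrow> ?thesis"
      by (auto simp: triple_carr W_ftr_def U_of_def triples_def assms)
  qed
  have a: "x \<in> Arr (triple_cat J n ?A' X) \<Longrightarrow> ar (W_ftr (U_of S)) x = ar (W_ftr (U_of S')) x" for x X
  proof -
    obtain i j k a b c t where "x = ((i,j,k),(a,b,c,t))" by (metis prod.exhaust)
    then show "x \<in> Arr (triple_cat J n ?A' X) \<Longrightarrow> ?thesis"
      by (auto split: prod.split simp: triple_carr W_ftr_def U_of_def triples_def assms)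
  qed
  let ?C = "triple_cat J n ?A' (discrete {0, 1})"
  have 1: "po_ob_rel ?C id_ftr (W_ftr (U_of S)) = po_ob_rel ?C id_ftr (W_ftr (U_of S'))"
    "po_ar_rel ?C id_ftr (W_ftr (U_of S)) = po_ar_rel ?C id_ftr (W_ftr (U_of S'))"
    unfolding po_rel_image using o a by (auto intro!: image_cong)
  show ?thesis unfolding next_stage_def Let_def t p pushout_def pushout_left_def pushout_right_def 1 ..
qed

lemma stage_1: "stage J 1 = \<lparr>st_cat = one_cat, st_V = to_one, st_U = to_one\<rparr>"
  by (subst stage.simps) simp

lemma stage_rec: "2 \<le> n \<Longrightarrow> stage J n = next_stage J n (stage J)"
  by (subst stage.simps) (simp, rule next_stage_cong, simp)

lemma encode_inj: "inj_on encode (eq_class R ` X)"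
proof (rule inj_onI)
  fix c d assume "c \<in> eq_class R ` X" "d \<in> eq_class R ` X" "encode c = encode d"
  then obtain x y where "c = eq_class R x" "d = eq_class R y" "some_elem c = some_elem d"
    by (auto simp: encode_def)
  then show "c = d" using some_elem_class by metis
qed

abbreviation "D_of J n A \<equiv> triple_cat J n A (indiscrete {0, 1})"
abbreviation "C_of J n A \<equiv> triple_cat J n A (discrete {0, 1})"

definition stage_ok where "stage_ok J n \<longleftrightarrow> groupoid (st_cat (stage J n)) \<and> (\<forall>a b. 1 \<le> a \<longrightarrow> 1 \<le> b \<longrightarrow> a + b = n \<longrightarrow>
    cat_functor (prod_cat (st_cat (stage J a)) (st_cat (stage J b))) (st_cat (stage J n)) (U_of (stage J) a b))"

lemma triple_groupoid: "(\<And>m. 1 \<le> m \<Longrightarrow> m < n \<Longrightarrow> groupoid (A m)) \<Longrightarrow> groupoid X \<Longrightarrow> groupoid (triple_cat J n A X)"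
  unfolding triple_cat_def by (rule coprod_groupoid) (auto simp: triples_def intro!: prod_groupoid)
lemma pair_groupoid: "(\<And>m. 1 \<le> m \<Longrightarrow> m < n \<Longrightarrow> groupoid (A m)) \<Longrightarrow> groupoid (pair_cat n A)"
  unfolding pair_cat_def by (rule coprod_groupoid) (auto simp: pairs_def intro!: prod_groupoid)

lemma W_functor:
  assumes A: "\<And>m. 1 \<le> m \<Longrightarrow> m < n \<Longrightarrow> groupoid (A m)"
   and U: "\<And>a b. 1 \<le> a \<Longrightarrow> 1 \<le> b \<Longrightarrow> a + b < n \<Longrightarrow> cat_functor (prod_cat (A a) (A b)) (A (a + b)) (U a b)"
  shows "cat_functor (C_of J n A) (pair_cat n A) (W_ftr U)"
proof (intro cat_functor.intro cat_functor_axioms.intro)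
  show "category (C_of J n A)" using triple_groupoid[OF A discrete_groupoid] by (simp add: groupoid_def)
  show "category (pair_cat n A)" using pair_groupoid[OF A] by (simp add: groupoid_def)
  have 1: "cat_functor (prod_cat (A j) (A k)) (A (j + k)) (U j k)"
    "cat_functor (prod_cat (A i) (A j)) (A (i + j)) (U i j)"
     "(i, j+k) \<in> pairs n" "(i+j, k) \<in> pairs n"
    if "(i,j,k) \<in> triples J n" for i j k
    using U that by (auto simp: triples_def pairs_def)
  note U = cat_functor.ob_in cat_functor.ar_in cat_functor.dom_ar cat_functor.cod_ar cat_functor.ar_id
  { fix x assume x: "x \<in> Obj (C_of J n A)"
    obtain i j k a b c t where x': "x = ((i,j,k),(a,b,c,t))" by (metis prod.exhaust)
    have tr: "(i,j,k) \<in> triples J n" and m: "a \<in> Obj (A i)" "b \<in> Obj (A j)" "c \<in> Obj (A k)" "t = 0 \<or> t = 1" using x x' by (auto simp: triple_carr discrete_def)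
    note 2 = 1[OF tr]
    note U1 = U[OF 2(1)] and U2 = U[OF 2(2)]
    show "ob (W_ftr U) x \<in> Obj (pair_cat n A)" "ar (W_ftr U) (Id (C_of J n A) x) = Id (pair_cat n A) (ob (W_ftr U) x)"
      using m 2(3,4) U1(1,5)[of "(b,c)"] U2(1,5)[of "(a,b)"] tr unfolding x'
      by (auto simp: W_ftr_def pair_carr pair_ops triple_ops prod_cat_def discrete_def)
  }
  { fix f assume f: "f \<in> Arr (C_of J n A)"
    obtain i j k a b c t t' where f': "f = ((i,j,k),(a,b,c,(t,t')))" by (metis prod.exhaust)
    have tr: "(i,j,k) \<in> triples J n" and m: "a \<in> Arr (A i)" "b \<in> Arr (A j)" "c \<in> Arr (A k)" "t' = t" "t = 0 \<or> t = 1" using f f' by (auto simp: triple_carr discrete_def)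
    note 2 = 1[OF tr]
    note U1 = U[OF 2(1)] and U2 = U[OF 2(2)]
    show "ar (W_ftr U) f \<in> Arr (pair_cat n A)" "Dom (pair_cat n A) (ar (W_ftr U) f) = ob (W_ftr U) (Dom (C_of J n A) f)"
     "Cod (pair_cat n A) (ar (W_ftr U) f) = ob (W_ftr U) (Cod (C_of J n A) f)"
      using m 2(3,4) U1(2-4)[of "(b,c)"] U2(2-4)[of "(a,b)"] tr unfolding f'
      by (auto simp: W_ftr_def pair_carr pair_ops triple_ops prod_cat_def discrete_def)
    fix g assume g: "g \<in> Arr (C_of J n A)" "Cod (C_of J n A) f = Dom (C_of J n A) g"
    obtain i' j' k' a' b' c' s s' where g': "g = ((i',j',k'),(a',b',c',(s,s')))" by (metis prod.exhaust)
    have tr': "(i',j',k') \<in> triples J n" using g g' by (auto simp: triple_carr)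
    have e: "i' = i" "j' = j" "k' = k" using g tr tr' f' g' by (auto simp: triple_ops)
    have m': "a' \<in> Arr (A i)" "b' \<in> Arr (A j)" "c' \<in> Arr (A k)" "s' = s" "s = t"
      "Cod (A i) a = Dom (A i) a'" "Cod (A j) b = Dom (A j) b'" "Cod (A k) c = Dom (A k) c'"
      using g f' g' m e tr by (auto simp: triple_carr triple_ops discrete_def)
    show "ar (W_ftr U) (Comp (C_of J n A) g f) = Comp (pair_cat n A) (ar (W_ftr U) g) (ar (W_ftr U) f)"
      using m m' tr 2(3,4) cat_functor.ar_comp[OF 2(1), of "(b,c)" "(b',c')"] cat_functor.ar_comp[OF 2(2), of "(a,b)" "(a',b')"]
      unfolding f' g' e by (auto simp: W_ftr_def pair_ops triple_ops prod_cat_def discrete_def)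
  }
qed

lemma incl_functor: assumes "groupoid (C_of J n A)" "groupoid (D_of J n A)"
  shows "cat_functor (C_of J n A) (D_of J n A) id_ftr"
proof (intro cat_functor.intro cat_functor_axioms.intro)
  show "category (C_of J n A)" "category (D_of J n A)" using assms by (simp_all add: groupoid_def)
qed (auto simp: triple_carr triple_ops id_ftr_def discrete_def indiscrete_def)

locale catalan_stage = fixes J :: "nat set" and n :: nat
  assumes n: "2 \<le> n" and IH: "\<And>m. 1 \<le> m \<Longrightarrow> m < n \<Longrightarrow> stage_ok J m"
begin
abbreviation "A \<equiv> \<lambda>m. st_cat (stage J m)"
abbreviation "W \<equiv> W_ftr (U_of (stage J))"

lemma grp: "1 \<le> m \<Longrightarrow> m < n \<Longrightarrow> groupoid (A m)" using IH by (simp add: stage_ok_def)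

sublocale pushout_square "C_of J n A" "D_of J n A" "pair_cat n A" id_ftr W
proof (intro pushout_square.intro W_functor incl_functor grp triple_groupoid discrete_groupoid indiscrete_groupoid)
  show "cat_functor (prod_cat (A a) (A b)) (A (a + b)) (U_of (stage J) a b)" if "1 \<le> a" "1 \<le> b" "a + b < n" for a b
    using IH[of "a + b"] that by (simp add: stage_ok_def)
qed

sublocale image_iso Po encode encode
  by (intro image_iso.intro image_iso_axioms.intro Po_category)
    (simp_all add: pushout_def quot_cat_def Let_def encode_inj)

lemma stage_eq: "st_cat (stage J n) = image_cat encode encode Po" "st_V (stage J n) = comp_ftr co inD" "st_U (stage J n) = comp_ftr co inE"
  unfolding stage_rec[OF n] next_stage_def Let_def by simp_all

lemma V_functor: "cat_functor (D_of J n A) (A n) (st_V (stage J n))"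
  unfolding stage_eq by (rule comp_functor[OF inD_functor co_functor])
lemma U_functor: "cat_functor (pair_cat n A) (A n) (st_U (stage J n))"
  unfolding stage_eq by (rule comp_functor[OF inE_functor co_functor])
lemma VU: "eq_ftr_on (C_of J n A) (comp_ftr (st_V (stage J n)) id_ftr) (comp_ftr (st_U (stage J n)) W)"
  using Po_commute unfolding stage_eq by (auto simp: eq_ftr_on_def comp_ftr_def)

lemma A_univ:
  assumes "cat_functor (D_of J n A) Z H" "cat_functor (pair_cat n A) Z G" "eq_ftr_on (C_of J n A) (comp_ftr H id_ftr) (comp_ftr G W)"
  shows "\<exists>M. cat_functor (A n) Z M \<and> eq_ftr_on (D_of J n A) (comp_ftr M (st_V (stage J n))) H
     \<and> eq_ftr_on (pair_cat n A) (comp_ftr M (st_U (stage J n))) G \<and>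
     (\<forall>M'. cat_functor (A n) Z M' \<and> eq_ftr_on (D_of J n A) (comp_ftr M' (st_V (stage J n))) H \<and>
         eq_ftr_on (pair_cat n A) (comp_ftr M' (st_U (stage J n))) G
        \<longrightarrow> eq_ftr_on (A n) M' M)"
proof -
  obtain M where M: "cat_functor Po Z M" "eq_ftr_on (D_of J n A) (comp_ftr M inD) H" "eq_ftr_on (pair_cat n A) (comp_ftr M inE) G"
    and u: "\<And>M'. cat_functor Po Z M' \<Longrightarrow> eq_ftr_on (D_of J n A) (comp_ftr M' inD) H \<Longrightarrow> eq_ftr_on (pair_cat n A) (comp_ftr M' inE) G \<Longrightarrow> eq_ftr_on Po M' M"
    using Po_univ[OF assms] by blast
  interpret iD: cat_functor "D_of J n A" Po inD by (rule inD_functor)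
  interpret iE: cat_functor "pair_cat n A" Po inE by (rule inE_functor)
  show ?thesis unfolding stage_eq
  proof (intro exI[of _ "comp_ftr M de"] conjI allI impI)
    show "cat_functor (image_cat encode encode Po) Z (comp_ftr M de)" by (rule comp_functor[OF de_functor M(1)])
    show "eq_ftr_on (D_of J n A) (comp_ftr (comp_ftr M de) (comp_ftr co inD)) H"
      "eq_ftr_on (pair_cat n A) (comp_ftr (comp_ftr M de) (comp_ftr co inE)) G"
      using M(2,3) de_co iD.ob_in iD.ar_in iE.ob_in iE.ar_in by (simp_all add: eq_ftr_on_def comp_ftr_def)
    fix M' assume a: "cat_functor I Z M' \<and> eq_ftr_on (D_of J n A) (comp_ftr M' (comp_ftr co inD)) H \<and>
          eq_ftr_on (pair_cat n A) (comp_ftr M' (comp_ftr co inE)) G"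
    have "eq_ftr_on Po (comp_ftr M' co) M"
      by (rule u) (use a comp_functor[OF co_functor] in \<open>auto simp: eq_ftr_on_def comp_ftr_def\<close>)
    then show "eq_ftr_on I M' (comp_ftr M de)"
      unfolding eq_ftr_on_def I_carr using de_co by (simp add: comp_ftr_def)
  qed
qed

lemma stage_ok: "stage_ok J n" unfolding stage_ok_def
proof (intro conjI allI impI)
  show "groupoid (A n)" unfolding stage_eq
    by (intro I_groupoid Po_groupoid triple_groupoid pair_groupoid grp indiscrete_groupoid)
  fix a b :: nat assume ab: "1 \<le> a" "1 \<le> b" "a + b = n"
  have 1: "cat_functor (prod_cat (A a) (A b)) (pair_cat n A) \<lparr>ob = Pair (a,b), ar = Pair (a,b)\<rparr>"
    using coprod_in_functor[of "pairs n" "\<lambda>(a,b). prod_cat (A a) (A b)" "(a,b)"] ab grp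
    by (force simp: pair_cat_def pairs_def groupoid_def intro!: prod_category)
  have "U_of (stage J) a b = comp_ftr (st_U (stage J n)) \<lparr>ob = Pair (a,b), ar = Pair (a,b)\<rparr>"
    using ab by (auto simp: U_of_def comp_ftr_def)
  then show "cat_functor (prod_cat (A a) (A b)) (A n) (U_of (stage J) a b)"
    using comp_functor[OF 1 U_functor] by simp
qed

lemma A_obj: "Obj (A n) = ob (st_U (stage J n)) ` Obj (pair_cat n A)"
proof -
  have "ob (st_V (stage J n)) x \<in> ob (st_U (stage J n)) ` Obj (pair_cat n A)" if "x \<in> Obj (D_of J n A)" for x
  proof -
    have "x \<in> Obj (C_of J n A)" using that by (cases x) (auto simp: triple_carr discrete_def indiscrete_def)
    then have "ob (st_V (stage J n)) x = ob (st_U (stage J n)) (ob W x)" "ob W x \<in> Obj (pair_cat n A)"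
      using VU G.ob_in by (auto simp: eq_ftr_on_def comp_ftr_def id_ftr_def)
    then show ?thesis by auto
  qed
  then have "ob (st_V (stage J n)) ` Obj (D_of J n A) \<subseteq> ob (st_U (stage J n)) ` Obj (pair_cat n A)" by (rule image_subsetI)
  moreover have "Obj (A n) = ob (st_V (stage J n)) ` Obj (D_of J n A) \<union> ob (st_U (stage J n)) ` Obj (pair_cat n A)"
    unfolding stage_eq I_carr Po_obj by (auto simp: comp_ftr_def)
  ultimately show ?thesis by (simp only: Un_absorb1)
qed

end

lemma stage_ok: "1 \<le> n \<Longrightarrow> stage_ok J n"
proof (induction n rule: less_induct)
  case (less n)
  show ?case
  proof (cases "2 \<le> n")
    case True
    interpret catalan_stage J n by unfold_locales (use True less in auto)
    show ?thesis by (rule stage_ok)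
  next
    case False
    then have "n = 1" using less by simp
    then show ?thesis by (auto simp: stage_ok_def stage_1[simplified] one_groupoid)
  qed
qed

lemma catalan_stageI: "2 \<le> n \<Longrightarrow> catalan_stage J n" by unfold_locales (auto intro: stage_ok)

lemma next_L_cong:
  assumes "\<And>m. m < n \<Longrightarrow> 1 \<le> m \<Longrightarrow> L m = L' m"
  shows "next_L n L = next_L n L'"
proof -
  have 1: "eq_ftr_on (triple_cat {1} n T_cat X) M (comp_ftr N (triple_ftr L)) \<longleftrightarrow> eq_ftr_on (triple_cat {1} n T_cat X) M (comp_ftr N (triple_ftr L'))"
    for X M N
    unfolding eq_ftr_on_def
    apply (intro conj_cong ball_cong refl)
    subgoal for x by (cases x) (auto simp: triple_carr comp_ftr_def triple_ftr_def assms triples_def)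
    subgoal for x by (cases x) (auto simp: triple_carr comp_ftr_def triple_ftr_def assms triples_def)
    done
  have 2: "eq_ftr_on (pair_cat n T_cat) M (comp_ftr N (pair_ftr L)) \<longleftrightarrow> eq_ftr_on (pair_cat n T_cat) M (comp_ftr N (pair_ftr L'))"
    for M N
    unfolding eq_ftr_on_def
    apply (intro conj_cong ball_cong refl)
    subgoal for x by (cases x) (auto simp: pair_carr comp_ftr_def pair_ftr_def assms pairs_def)
    subgoal for x by (cases x) (auto simp: pair_carr comp_ftr_def pair_ftr_def assms pairs_def)
    done
  show ?thesis unfolding next_L_def induced_ftr_def 1 2 ..
qed

lemma L_1: "L_ftr 1 = id_ftr" by (subst L_ftr.simps) simp
lemma L_rec: "2 \<le> n \<Longrightarrow> L_ftr n = next_L n L_ftr"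
  by (subst L_ftr.simps) (simp, rule next_L_cong, simp)

lemma T1: "T_cat 1 = one_cat" "A_cat 1 = one_cat" by (simp_all only: T_cat_def A_cat_def stage_1 stage_data.simps)

definition L_ok where "L_ok n \<longleftrightarrow> cat_functor (T_cat n) (A_cat n) (L_ftr n) \<and>
   ob (L_ftr n) ` Obj (T_cat n) = Obj (A_cat n) \<and>
   (\<forall>a b. 1 \<le> a \<longrightarrow> 1 \<le> b \<longrightarrow> a + b = n \<longrightarrow>
     eq_ftr_on (prod_cat (T_cat a) (T_cat b)) (comp_ftr (L_ftr n) (U_of (stage {1}) a b))
      (comp_ftr (U_of (stage {1..}) a b) \<lparr>ob = map_prod (ob (L_ftr a)) (ob (L_ftr b)), ar = map_prod (ar (L_ftr a)) (ar (L_ftr b))\<rparr>))"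

lemma L_ok_step: assumes n: "2 \<le> n" and IH: "\<And>m. 1 \<le> m \<Longrightarrow> m < n \<Longrightarrow> L_ok m" shows "L_ok n"
proof -
  interpret T: catalan_stage "{1}" n by (rule catalan_stageI[OF n])
  interpret A: catalan_stage "{1..}" n by (rule catalan_stageI[OF n])
  note TV = T.V_functor[folded T_cat_def] and AV = A.V_functor[folded A_cat_def]
  note TU = T.U_functor[folded T_cat_def] and AU = A.U_functor[folded A_cat_def]
  note AVU = A.VU[folded A_cat_def] and Tuniv = T.A_univ[folded T_cat_def]
  note Tobj = T.A_obj[folded T_cat_def] and Aobj = A.A_obj[folded A_cat_def]
  have L: "cat_functor (T_cat m) (A_cat m) (L_ftr m)" if "1 \<le> m" "m < n" for m using IH[OF that] by (simp add: L_ok_def)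
  note La = L[THEN cat_functor.ob_in] L[THEN cat_functor.ar_in] L[THEN cat_functor.dom_ar] L[THEN cat_functor.cod_ar] L[THEN cat_functor.ar_id] L[THEN cat_functor.ar_comp]
  have tri: "cat_functor (D_of {1} n T_cat) (D_of {1..} n A_cat) (triple_ftr L_ftr)"
  proof (intro cat_functor.intro cat_functor_axioms.intro)
    show "category (D_of {1} n T_cat)" "category (D_of {1..} n A_cat)"
      using TV AV unfolding cat_functor_def by blast+
  qed (auto simp: triple_ftr_def triple_carr triple_ops La triples_def)
  have pr: "cat_functor (pair_cat n T_cat) (pair_cat n A_cat) (pair_ftr L_ftr)"
  proof (intro cat_functor.intro cat_functor_axioms.intro)
    show "category (pair_cat n T_cat)" "category (pair_cat n A_cat)"
      using TU AU unfolding cat_functor_def by blast+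
  qed (auto simp: pair_ftr_def pair_carr pair_ops La pairs_def)
  let ?H = "comp_ftr (st_V (stage {1..} n)) (triple_ftr L_ftr)"
  let ?K = "comp_ftr (st_U (stage {1..} n)) (pair_ftr L_ftr)"
  have H: "cat_functor (D_of {1} n T_cat) (A_cat n) ?H" by (rule comp_functor[OF tri AV])
  have K: "cat_functor (pair_cat n T_cat) (A_cat n) ?K" by (rule comp_functor[OF pr AU])
  have UL: "eq_ftr_on (prod_cat (T_cat a) (T_cat b)) (comp_ftr (L_ftr (a+b)) (U_of (stage {1}) a b))
      (comp_ftr (U_of (stage {1..}) a b) \<lparr>ob = map_prod (ob (L_ftr a)) (ob (L_ftr b)), ar = map_prod (ar (L_ftr a)) (ar (L_ftr b))\<rparr>)"
    if "1 \<le> a" "1 \<le> b" "a + b < n" for a b using IH[of "a + b"] that by (simp add: L_ok_def)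
  have ULo: "ob (L_ftr (a+b)) (ob (U_of (stage {1}) a b) (x, y)) = ob (U_of (stage {1..}) a b) (ob (L_ftr a) x, ob (L_ftr b) y)"
    if "1 \<le> a" "1 \<le> b" "a + b < n" "x \<in> Obj (T_cat a)" "y \<in> Obj (T_cat b)" for a b x y
    using UL[OF that(1-3)] that(4,5) by (auto simp: eq_ftr_on_def comp_ftr_def prod_cat_def)
  have ULa: "ar (L_ftr (a+b)) (ar (U_of (stage {1}) a b) (x, y)) = ar (U_of (stage {1..}) a b) (ar (L_ftr a) x, ar (L_ftr b) y)"
    if "1 \<le> a" "1 \<le> b" "a + b < n" "x \<in> Arr (T_cat a)" "y \<in> Arr (T_cat b)" for a b x y
    using UL[OF that(1-3)] that(4,5) by (auto simp: eq_ftr_on_def comp_ftr_def prod_cat_def)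
  have o: "ob ?H x = ob ?K (ob T.W x)" if "x \<in> Obj (C_of {1} n T_cat)" for x
  proof -
    obtain i j k a b c t where x: "x = ((i,j,k),(a,b,c,t))" by (metis prod.exhaust)
    have tr: "(i,j,k) \<in> triples {1} n" and m: "a \<in> Obj (T_cat i)" "b \<in> Obj (T_cat j)" "c \<in> Obj (T_cat k)" "t = 0 \<or> t = 1"
      using that by (auto simp: x triple_carr discrete_def)
    have trA: "(i,j,k) \<in> triples {1..} n" using tr by (auto simp: triples_def)
    have "ob (triple_ftr L_ftr) x \<in> Obj (C_of {1..} n A_cat)"
      using m tr trA by (auto simp: x triple_ftr_def triple_carr discrete_def La triples_def)
    then have "ob (st_V (stage {1..} n)) (ob (triple_ftr L_ftr) x) = ob (st_U (stage {1..} n)) (ob A.W (ob (triple_ftr L_ftr) x))"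
      using AVU by (simp add: eq_ftr_on_def comp_ftr_def id_ftr_def)
    also have "ob A.W (ob (triple_ftr L_ftr) x) = ob (pair_ftr L_ftr) (ob T.W x)"
      using m tr ULo[of j k b c] ULo[of i j a b] by (auto simp: x triple_ftr_def W_ftr_def pair_ftr_def triples_def)
    finally show ?thesis by (simp add: comp_ftr_def)
  qed
  have a: "ar ?H x = ar ?K (ar T.W x)" if "x \<in> Arr (C_of {1} n T_cat)" for x
  proof -
    obtain i j k a b c t t' where x: "x = ((i,j,k),(a,b,c,(t,t')))" by (metis prod.exhaust)
    have tr: "(i,j,k) \<in> triples {1} n" and m: "a \<in> Arr (T_cat i)" "b \<in> Arr (T_cat j)" "c \<in> Arr (T_cat k)" "t' = t" "t = 0 \<or> t = 1"
      using that by (auto simp: x triple_carr discrete_def)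
    have trA: "(i,j,k) \<in> triples {1..} n" using tr by (auto simp: triples_def)
    have "ar (triple_ftr L_ftr) x \<in> Arr (C_of {1..} n A_cat)"
      using m tr trA by (auto simp: x triple_ftr_def triple_carr discrete_def La triples_def)
    then have "ar (st_V (stage {1..} n)) (ar (triple_ftr L_ftr) x) = ar (st_U (stage {1..} n)) (ar A.W (ar (triple_ftr L_ftr) x))"
      using AVU by (simp add: eq_ftr_on_def comp_ftr_def id_ftr_def)
    also have "ar A.W (ar (triple_ftr L_ftr) x) = ar (pair_ftr L_ftr) (ar T.W x)"
      using m tr ULa[of j k b c] ULa[of i j a b] by (auto simp: x triple_ftr_def W_ftr_def pair_ftr_def triples_def)
    finally show ?thesis by (simp add: comp_ftr_def)
  qed
  have cone: "eq_ftr_on (C_of {1} n T_cat) (comp_ftr ?H id_ftr) (comp_ftr ?K T.W)"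
    unfolding eq_ftr_on_def
  proof (intro conjI ballI)
    fix x assume "x \<in> Obj (C_of {1} n T_cat)"
    from o[OF this] show "ob (comp_ftr ?H id_ftr) x = ob (comp_ftr ?K T.W) x" by (simp add: comp_ftr_def id_ftr_def)
  next
    fix x assume "x \<in> Arr (C_of {1} n T_cat)"
    from a[OF this] show "ar (comp_ftr ?H id_ftr) x = ar (comp_ftr ?K T.W) x" by (simp add: comp_ftr_def id_ftr_def)
  qed
  have "cat_functor (T_cat n) (A_cat n) (L_ftr n) \<and> eq_ftr_on (D_of {1} n T_cat) (comp_ftr (L_ftr n) (st_V (stage {1} n))) ?H
     \<and> eq_ftr_on (pair_cat n T_cat) (comp_ftr (L_ftr n) (st_U (stage {1} n))) ?K"
    unfolding L_rec[OF n] next_L_def induced_ftr_def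
    by (rule someI_ex) (use Tuniv[OF H K cone] in blast)
  then have f: "cat_functor (T_cat n) (A_cat n) (L_ftr n)" and
    LU: "eq_ftr_on (pair_cat n T_cat) (comp_ftr (L_ftr n) (st_U (stage {1} n))) ?K" by auto
  show ?thesis unfolding L_ok_def
  proof (intro conjI f allI impI)
    have "ob (L_ftr n) ` Obj (T_cat n) = ob ?K ` Obj (pair_cat n T_cat)"
      using LU Tobj by (simp add: eq_ftr_on_def comp_ftr_def image_image)
    also have "... = ob (st_U (stage {1..} n)) ` ob (pair_ftr L_ftr) ` Obj (pair_cat n T_cat)"
      by (simp add: comp_ftr_def image_image)
    also have "ob (pair_ftr L_ftr) ` Obj (pair_cat n T_cat) = Obj (pair_cat n A_cat)"
    proof (rule subset_antisym)
      show "ob (pair_ftr L_ftr) ` Obj (pair_cat n T_cat) \<subseteq> Obj (pair_cat n A_cat)"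
        using pr[THEN cat_functor.ob_in] by auto
      show "Obj (pair_cat n A_cat) \<subseteq> ob (pair_ftr L_ftr) ` Obj (pair_cat n T_cat)"
      proof
        fix x assume x: "x \<in> Obj (pair_cat n A_cat)"
        obtain a b u v where x': "x = ((a,b),(u,v))" by (metis prod.exhaust)
        have p: "(a,b) \<in> pairs n" "u \<in> Obj (A_cat a)" "v \<in> Obj (A_cat b)" using x x' by (auto simp: pair_carr)
        have "ob (L_ftr a) ` Obj (T_cat a) = Obj (A_cat a)" "ob (L_ftr b) ` Obj (T_cat b) = Obj (A_cat b)"
          using p IH by (auto simp: pairs_def L_ok_def)
        then obtain u' v' where "u' \<in> Obj (T_cat a)" "v' \<in> Obj (T_cat b)" "u = ob (L_ftr a) u'" "v = ob (L_ftr b) v'"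
          using p by (metis imageE)
        then show "x \<in> ob (pair_ftr L_ftr) ` Obj (pair_cat n T_cat)" using x' p
          by (auto intro!: image_eqI[of _ _ "((a,b),(u',v'))"] simp: pair_ftr_def pair_carr)
      qed
    qed
    also have "ob (st_U (stage {1..} n)) ` Obj (pair_cat n A_cat) = Obj (A_cat n)"
      using Aobj by simp
    finally show "ob (L_ftr n) ` Obj (T_cat n) = Obj (A_cat n)" .
    fix a b :: nat assume ab: "1 \<le> a" "1 \<le> b" "a + b = n"
    then have p: "(a,b) \<in> pairs n" by (simp add: pairs_def)
    show "eq_ftr_on (prod_cat (T_cat a) (T_cat b)) (comp_ftr (L_ftr n) (U_of (stage {1}) a b))
      (comp_ftr (U_of (stage {1..}) a b) \<lparr>ob = map_prod (ob (L_ftr a)) (ob (L_ftr b)), ar = map_prod (ar (L_ftr a)) (ar (L_ftr b))\<rparr>)"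
      using LU p ab by (auto simp: eq_ftr_on_def comp_ftr_def pair_carr U_of_def prod_cat_def pair_ftr_def)
  qed
qed

lemma L_ok: "1 \<le> n \<Longrightarrow> L_ok n"
proof (induction n rule: less_induct)
  case (less n)
  show ?case
  proof (cases "2 \<le> n")
    case True then show ?thesis using L_ok_step less by auto
  next
    case False
    then have n: "n = 1" using less by simp
    show ?thesis unfolding n L_ok_def T1 L_1
      by (auto intro!: cat_functor.intro cat_functor_axioms.intro simp: id_ftr_def one_groupoid[THEN groupoid.axioms(1)])
  qed
qed

theorem pi_group: assumes "1 \<le> n" shows "group (pi_A n)" "\<exists>X. Obj (pushout (T_cat n) one_cat (A_cat n) to_one (L_ftr n)) = {X}"
proof -
  have L: "cat_functor (T_cat n) (A_cat n) (L_ftr n)" and s: "ob (L_ftr n) ` Obj (T_cat n) = Obj (A_cat n)"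
    using L_ok[OF assms] by (auto simp: L_ok_def)
  interpret L: cat_functor "T_cat n" "A_cat n" "L_ftr n" by (rule L)
  interpret pushout_square "T_cat n" one_cat "A_cat n" to_one "L_ftr n"
    by (intro pushout_square.intro to_one_functor L) unfold_locales
  have g: "groupoid Po" using Po_groupoid one_groupoid stage_ok[OF assms, of "{1..}"] by (simp add: stage_ok_def A_cat_def)
  interpret P: groupoid Po by (rule g)
  have "ob inE y = ob inD 0" if "y \<in> Obj (A_cat n)" for y
  proof -
    obtain x where "x \<in> Obj (T_cat n)" "y = ob (L_ftr n) x" using \<open>y \<in> _\<close> unfolding s[symmetric] by auto
    then show ?thesis using Po_commute by (auto simp: eq_ftr_on_def comp_ftr_def to_one_def)
  qed
  then have X: "Obj Po = {ob inD 0}" unfolding Po_obj by (auto simp: one_cat_def)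
  then show "\<exists>X. Obj Po = {X}" by auto
  have dc: "Dom Po f = ob inD 0" "Cod Po f = ob inD 0" if "f \<in> Arr Po" for f
    using P.dom_obj P.cod_obj that X by auto
  have t: "(THE x. x \<in> Obj Po) = ob inD 0" using X by simp
  show "group (pi_A n)"
  proof (rule groupI)
    fix x assume x: "x \<in> carrier (pi_A n)"
    then show "\<one>\<^bsub>pi_A n\<^esub> \<otimes>\<^bsub>pi_A n\<^esub> x = x" using P.id_comp[of x] by (simp add: pi_A_def monoid_of_def t dc)
    show "\<exists>y\<in>carrier (pi_A n). y \<otimes>\<^bsub>pi_A n\<^esub> x = \<one>\<^bsub>pi_A n\<^esub>"
      using P.inverse[of x] x by (auto simp: pi_A_def monoid_of_def t dc)
  qed (auto simp: pi_A_def monoid_of_def dc t P.comp_arr P.comp_assoc P.id_arr X)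
qed


section \<open>Free groups are groups\<close>

lemma reduced_Cons: "reduced (a # w) \<longleftrightarrow> reduced w \<and> (w = [] \<or> \<not> inverse_letters a (hd w))"
  by (auto simp: reduced_def successively_Cons)

lemma reduced_cons_reduce: "reduced w \<Longrightarrow> reduced (cons_reduce a w)"
  by (cases w) (auto simp: reduced_Cons)

lemma set_cons_reduce: "set (cons_reduce a w) \<subseteq> insert a (set w)"
  by (cases w) auto

lemma reduced_foldr: "reduced v \<Longrightarrow> reduced (foldr cons_reduce u v)"
  by (induction u) (auto intro: reduced_cons_reduce)

lemma set_foldr: "set (foldr cons_reduce u v) \<subseteq> set u \<union> set v"
  using set_cons_reduce by (induction u) fastforce+

definition flip_letter :: "'x \<times> bool \<Rightarrow> 'x \<times> bool"
  where "flip_letter a = (fst a, \<not> snd a)"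

lemma inverse_letters_iff: "inverse_letters a b \<longleftrightarrow> b = flip_letter a"
  by (cases a; cases b) (auto simp: inverse_letters_def flip_letter_def)

lemma flip_flip [simp]: "flip_letter (flip_letter a) = a"
  by (cases a) (simp add: flip_letter_def)

lemma cons_reduce_cancel: "reduced w \<Longrightarrow> cons_reduce a (cons_reduce (flip_letter a) w) = w"
proof (cases w)
  case (Cons b v)
  assume "reduced w"
  then show ?thesis using Cons by (cases v) (auto simp: inverse_letters_iff reduced_Cons)
qed (simp add: inverse_letters_iff)

lemma foldr_cons_reduce:
  "reduced x \<Longrightarrow> reduced w \<Longrightarrow>
    foldr cons_reduce (cons_reduce a x) w = cons_reduce a (foldr cons_reduce x w)"
  using cons_reduce_cancel[OF reduced_foldr, of w a]
  by (cases x) (auto simp: inverse_letters_iff)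

lemma foldr_assoc:
  "reduced v \<Longrightarrow> reduced w \<Longrightarrow>
    foldr cons_reduce (foldr cons_reduce u v) w = foldr cons_reduce u (foldr cons_reduce v w)"
  by (induction u) (auto simp: foldr_cons_reduce reduced_foldr)

lemma foldr_normal:
  "reduced w \<Longrightarrow> foldr cons_reduce (foldr cons_reduce u []) w = foldr cons_reduce u w"
  using foldr_assoc[of "[]" w u] by (simp add: reduced_def)

lemma foldr_Nil: "reduced w \<Longrightarrow> foldr cons_reduce w [] = w"
proof (induction w)
  case (Cons a w) then show ?case by (cases w) (auto simp: reduced_Cons)
qed simp

lemma foldr_inverse:
  "reduced w \<Longrightarrow> foldr cons_reduce (foldr cons_reduce (rev (map flip_letter w)) []) w = []"
proof (induction w)
  case (Cons a w)
  have r: "reduced w" using Cons.prems by (simp add: reduced_Cons)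
  let ?i = "rev (map flip_letter w)"
  have "foldr cons_reduce (foldr cons_reduce (rev (map flip_letter (a # w))) []) (a # w)
      = foldr cons_reduce (rev (map flip_letter (a # w))) (a # w)"
    by (rule foldr_normal) (rule Cons.prems)
  also have "\<dots> = foldr cons_reduce ?i w"
    by (simp add: inverse_letters_iff)
  also have "\<dots> = foldr cons_reduce (foldr cons_reduce ?i []) w"
    by (rule foldr_normal[symmetric]) (rule r)
  also have "\<dots> = []" by (rule Cons.IH[OF r])
  finally show ?case .
qed simp

lemma free_group_group: "group (free_group X)"
proof (rule groupI)
  fix x assume x: "x \<in> carrier (free_group X)"
  show "\<exists>y\<in>carrier (free_group X). y \<otimes>\<^bsub>free_group X\<^esub> x = \<one>\<^bsub>free_group X\<^esub>"
  proof (rule bexI)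
    let ?y = "foldr cons_reduce (rev (map flip_letter x)) []"
    show "?y \<otimes>\<^bsub>free_group X\<^esub> x = \<one>\<^bsub>free_group X\<^esub>"
      using x by (simp add: free_group_def foldr_inverse)
    have "fst ` set ?y \<subseteq> fst ` set x"
      using set_foldr[of "rev (map flip_letter x)" "[]"] by (force simp: flip_letter_def)
    then show "?y \<in> carrier (free_group X)"
      using x by (auto simp: free_group_def intro!: reduced_foldr) (auto simp: reduced_def)
  qed
next
  fix x y assume a: "x \<in> carrier (free_group X)" "y \<in> carrier (free_group X)"
  have "fst ` set (foldr cons_reduce x y) \<subseteq> fst ` set x \<union> fst ` set y"
    using image_mono[OF set_foldr[of x y], of fst] by (simp add: image_Un)
  also have "\<dots> \<subseteq> X" using a by (simp add: free_group_def)
  finally show "x \<otimes>\<^bsub>free_group X\<^esub> y \<in> carrier (free_group X)"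
    using a by (simp add: free_group_def reduced_foldr)
qed (auto simp: free_group_def foldr_assoc foldr_Nil reduced_def)

end

theory Submission
  imports Defs "HOL-Library.Product_Plus"
begin

text \<open>
  Inserting the pentagon of \<open>\<^bold>A\<^sub>4\<close> into the first factor of a pentagon with block sizes
  \<open>(4, 1, 1, n - 6)\<close> gives two loops of \<open>\<^bold>A\<^sub>n\<close>, which commute because the outer pentagon is natural in
  that factor.  Counting associativity moves with weights that depend only on the block sizes is
  compatible with all relations of \<open>\<^bold>A\<^sub>n\<close>, since no pentagon relation is imposed, and it is trivial on
  \<open>\<^bold>T\<^sub>n\<close> if the moves with middle block of size 1 have weight 0.  Suitable weights give a homomorphism
  from the fundamental group to \<open>\<int>\<^sup>2\<close> under which the two loops become linearly independent.  In a free
  group this is impossible for commuting elements.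
\<close>

section \<open>Commuting elements of free groups\<close>

text \<open>The triple (a, b, c) stands for the upper unitriangular 3 by 3 matrix with a and b above
  the diagonal and c in the corner, and \<open>heis\<close> is the matrix product.\<close>

fun heis :: "int \<times> int \<times> int \<Rightarrow> int \<times> int \<times> int \<Rightarrow> int \<times> int \<times> int"
  where "heis (a, b, c) (a', b', c') = (a + a', b + b', c + c' + a * b')"

lemma heis_assoc: "heis (heis u v) w = heis u (heis v w)"
  by (cases u; cases v; cases w) (simp add: algebra_simps)

lemma heis_commute_iff: "heis (a, b, c) (a', b', c') = heis (a', b', c') (a, b, c) \<longleftrightarrow> a * b' = a' * b"
  by auto

text \<open>The triple (-a, -b, a * b) is the inverse matrix of (a, b, 0), so formal inverses of
  letters go to inverses.\<close>

definition heis_letter :: "('x \<Rightarrow> int) \<Rightarrow> ('x \<Rightarrow> int) \<Rightarrow> 'x \<times> bool \<Rightarrow> int \<times> int \<times> int"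
  where "heis_letter p q l = (let a = p (fst l); b = q (fst l) in if snd l then (a, b, 0) else (- a, - b, a * b))"

definition heis_word :: "('x \<Rightarrow> int) \<Rightarrow> ('x \<Rightarrow> int) \<Rightarrow> ('x \<times> bool) list \<Rightarrow> int \<times> int \<times> int"
  where "heis_word p q w = foldr (\<lambda>l. heis (heis_letter p q l)) w (0, 0, 0)"

lemma heis_letter_cancel: "heis (heis_letter p q l) (heis (heis_letter p q (flip_letter l)) u) = u"
  by (cases u) (simp add: heis_letter_def flip_letter_def Let_def algebra_simps)

lemma heis_word_cons_reduce:
  "heis_word p q (cons_reduce l w) = heis (heis_letter p q l) (heis_word p q w)"
  by (cases w) (auto simp: heis_word_def heis_letter_cancel inverse_letters_iff)

text \<open>Free reduction only cancels a letter against its inverse, which the matrix product does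
  as well. Thus any values on the generators extend to a homomorphism from the free group to the
  Heisenberg group.\<close>

lemma heis_word_mult:
  "heis_word p q (foldr cons_reduce u v) = heis (heis_word p q u) (heis_word p q v)"
proof (induction u)
  case Nil
  show ?case by (cases "heis_word p q v") (simp add: heis_word_def[of _ _ "[]"])
next
  case (Cons l u)
  then show ?case by (simp add: heis_word_cons_reduce heis_assoc) (simp add: heis_word_def heis_assoc)
qed

text \<open>These rules compute \<alpha> from its values on generators. In the last one, reducedness
  of \<open>l # w\<close> makes the product of \<open>[l]\<close> and \<open>w\<close> plain
  concatenation.\<close>

lemma hom_letters:
  fixes \<alpha> :: "('x \<times> bool) list \<Rightarrow> int"
  assumes hom: "\<forall>u\<in>carrier (free_group X). \<forall>v\<in>carrier (free_group X).
      \<alpha> (u \<otimes>\<^bsub>free_group X\<^esub> v) = \<alpha> u + \<alpha> v"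
  shows "\<alpha> [] = 0"
    and "x \<in> X \<Longrightarrow> \<alpha> [(x, False)] = - \<alpha> [(x, True)]"
    and "l # w \<in> carrier (free_group X) \<Longrightarrow> \<alpha> (l # w) = \<alpha> [l] + \<alpha> w"
proof -
  show 0: "\<alpha> [] = 0" using hom[rule_format, of "[]" "[]"] by (simp add: free_group_def reduced_def)
  show "x \<in> X \<Longrightarrow> \<alpha> [(x, False)] = - \<alpha> [(x, True)]"
    using hom[rule_format, of "[(x, False)]" "[(x, True)]"] 0
    by (simp add: free_group_def reduced_def inverse_letters_def)
  show "\<alpha> (l # w) = \<alpha> [l] + \<alpha> w" if "l # w \<in> carrier (free_group X)"
    using hom[rule_format, of "[l]" w] that
    by (cases w) (auto simp: free_group_def reduced_Cons, simp add: reduced_def)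
qed

text \<open>A homomorphism from a free group to \<open>\<int>\<^sup>2\<close> lifts to the integral Heisenberg group, where the
  commutator of two elements is the determinant of their images in \<open>\<int>\<^sup>2\<close>.\<close>

lemma free_group_commuting:
  fixes \<alpha> \<beta> :: "('x \<times> bool) list \<Rightarrow> int"
  assumes \<alpha>: "\<forall>u\<in>carrier (free_group X). \<forall>v\<in>carrier (free_group X).
      \<alpha> (u \<otimes>\<^bsub>free_group X\<^esub> v) = \<alpha> u + \<alpha> v"
    and \<beta>: "\<forall>u\<in>carrier (free_group X). \<forall>v\<in>carrier (free_group X).
      \<beta> (u \<otimes>\<^bsub>free_group X\<^esub> v) = \<beta> u + \<beta> v"
    and c: "u \<in> carrier (free_group X)" "v \<in> carrier (free_group X)"
    and comm: "u \<otimes>\<^bsub>free_group X\<^esub> v = v \<otimes>\<^bsub>free_group X\<^esub> u"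
  shows "\<alpha> u * \<beta> v = \<alpha> v * \<beta> u"
proof -
  let ?h = "heis_word (\<lambda>x. \<alpha> [(x, True)]) (\<lambda>x. \<beta> [(x, True)])"
  note \<alpha>' = hom_letters[of X \<alpha>, OF \<alpha>] and \<beta>' = hom_letters[of X \<beta>, OF \<beta>]
  \<comment> \<open>The first two coordinates add up letter by letter exactly as \<alpha> and
    \<beta> do; the corner entry stays some integer r.\<close>
  have lift: "\<exists>r. ?h w = (\<alpha> w, \<beta> w, r)" if "w \<in> carrier (free_group X)" for w
    using that
  proof (induction w)
    case Nil
    then show ?case using \<alpha>'(1) \<beta>'(1) by (simp add: heis_word_def)
  next
    case (Cons l w)
    have w: "w \<in> carrier (free_group X)" and l: "fst l \<in> X"
      using Cons.prems by (auto simp: free_group_def reduced_Cons)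
    obtain r where "?h w = (\<alpha> w, \<beta> w, r)" using Cons.IH[OF w] by auto
    then show ?case using \<alpha>'(3)[OF Cons.prems] \<beta>'(3)[OF Cons.prems] \<alpha>'(2)[OF l] \<beta>'(2)[OF l]
      by (cases l) (auto simp: heis_word_def heis_letter_def Let_def)
  qed
  obtain r s where "?h u = (\<alpha> u, \<beta> u, r)" "?h v = (\<alpha> v, \<beta> v, s)" using lift c by blast
  moreover have "heis (?h u) (?h v) = heis (?h v) (?h u)"
    using arg_cong[OF comm, of ?h] by (simp add: free_group_def heis_word_mult)
  ultimately show ?thesis by (simp add: heis_commute_iff)
qed

text \<open>Pulled back along an isomorphism with a free group, the two coordinates of \<phi> are
  homomorphisms to the integers, and their determinant on a commuting pair of words
  vanishes.\<close>

lemma not_free_if_commuting_independent: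
  fixes \<phi> :: "'g \<Rightarrow> int \<times> int"
  assumes G: "group G"
    and hom: "\<And>x y. \<lbrakk>x \<in> carrier G; y \<in> carrier G\<rbrakk>
      \<Longrightarrow> \<phi> (x \<otimes>\<^bsub>G\<^esub> y) = \<phi> x + \<phi> y"
    and ab: "a \<in> carrier G" "b \<in> carrier G" "a \<otimes>\<^bsub>G\<^esub> b = b \<otimes>\<^bsub>G\<^esub> a"
    and det: "fst (\<phi> a) * snd (\<phi> b) \<noteq> fst (\<phi> b) * snd (\<phi> a)"
  shows "\<not> is_free_group G"
proof
  assume "is_free_group G"
  then obtain X :: "'g set" and h where h: "h \<in> iso G (free_group X)"
    by (auto simp: is_free_group_def is_iso_def)
  let ?k = "inv_into (carrier G) h"
  have bij: "bij_betw h (carrier G) (carrier (free_group X))"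
    and hh: "\<And>x y. \<lbrakk>x \<in> carrier G; y \<in> carrier G\<rbrakk> \<Longrightarrow> h (x \<otimes>\<^bsub>G\<^esub> y) = h x \<otimes>\<^bsub>free_group X\<^esub> h y"
    using h by (auto simp: iso_def hom_def)
  have k: "?k \<in> iso (free_group X) G" by (rule group.iso_set_sym[OF G h])
  then have kk: "\<And>u v. \<lbrakk>u \<in> carrier (free_group X); v \<in> carrier (free_group X)\<rbrakk>
      \<Longrightarrow> ?k u \<in> carrier G \<and> ?k v \<in> carrier G \<and> ?k (u \<otimes>\<^bsub>free_group X\<^esub> v) = ?k u \<otimes>\<^bsub>G\<^esub> ?k v"
    by (auto simp: iso_def hom_def)
  have kh: "?k (h x) = x" if "x \<in> carrier G" for x
    using bij that by (simp add: bij_betw_inv_into_left)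
  have hc: "h x \<in> carrier (free_group X)" if "x \<in> carrier G" for x
    using bij that by (auto simp: bij_betw_def)
  have "fst (\<phi> (?k (h a))) * snd (\<phi> (?k (h b))) = fst (\<phi> (?k (h b))) * snd (\<phi> (?k (h a)))"
    by (rule free_group_commuting[where \<alpha> = "\<lambda>u. fst (\<phi> (?k u))" and \<beta> = "\<lambda>u. snd (\<phi> (?k u))" and X = X])
      (use kk hom hh ab hc in \<open>auto simp flip: hh\<close>)
  then show False using det ab by (simp add: kh)
qed

section \<open>Additive functors on the Catalan groupoids\<close>

text \<open>An abelian group as a category with one object. Functors into it are additive functions
  on arrows, so universal properties of pushouts can produce such functions.\<close>

definition add_cat :: "(unit, 'a::ab_group_add) cat"
  where "add_cat = \<lparr>Obj = UNIV, Arr = UNIV, Dom = (\<lambda>_. ()), Cod = (\<lambda>_. ()),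
    Id = (\<lambda>_. 0), Comp = (+)\<rparr>"

definition add_ftr :: "('m \<Rightarrow> 'a) \<Rightarrow> ('o, 'm, unit, 'a) ftr"
  where "add_ftr \<phi> = \<lparr>ob = (\<lambda>_. ()), ar = \<phi>\<rparr>"

lemma add_category: "category add_cat"
  by unfold_locales (simp_all add: add_cat_def add.assoc)

lemma add_functor_iff:
  "cat_functor C add_cat (add_ftr \<phi>) \<longleftrightarrow> category C \<and> (\<forall>x\<in>Obj C. \<phi> (Id C x) = 0) \<and>
    (\<forall>f\<in>Arr C. \<forall>g\<in>Arr C. Cod C f = Dom C g \<longrightarrow> \<phi> (Comp C g f) = \<phi> g + \<phi> f)"
  using add_category
  by (auto simp: cat_functor_def cat_functor_axioms_def add_ftr_def) (auto simp: add_cat_def)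

lemma add_ftr_ar: "add_ftr (ar F) = F"
  by (cases F) (simp add: add_ftr_def fun_eq_iff)

lemma comp_add_ftr: "comp_ftr (add_ftr \<phi>) F = add_ftr (\<lambda>f. \<phi> (ar F f))"
  by (simp add: comp_ftr_def add_ftr_def)

lemma eq_add_ftr: "eq_ftr_on C (add_ftr \<phi>) (add_ftr \<psi>) \<longleftrightarrow> (\<forall>f\<in>Arr C. \<phi> f = \<psi> f)"
  by (simp add: eq_ftr_on_def add_ftr_def)

section \<open>Weights of associativity moves\<close>

definition pair_weight :: "(nat \<Rightarrow> nat \<Rightarrow> 'a::ab_group_add) \<Rightarrow> (nat \<times> nat) \<times> nat \<times> nat \<Rightarrow> 'a"
  where "pair_weight \<phi> = (\<lambda>((a, b), (f, g)). \<phi> a f + \<phi> b g)"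

text \<open>The arrow from 0 to 1 is the move from x(yz) to (xy)z and the arrow from 1 to 0 is its
  inverse, hence the opposite signs.\<close>

definition triple_weight :: "(nat \<Rightarrow> nat \<Rightarrow> nat \<Rightarrow> 'a::ab_group_add) \<Rightarrow> (nat \<Rightarrow> nat \<Rightarrow> 'a)
    \<Rightarrow> tri \<times> nat \<times> nat \<times> nat \<times> nat \<times> nat \<Rightarrow> 'a"
  where "triple_weight w \<phi> = (\<lambda>((i, j, k), (f, g, h, (t, t'))).
    \<phi> i f + \<phi> j g + \<phi> k h + (if t = t' then 0 else if t = 0 then w i j k else - w i j k))"

text \<open>An additive functor assigns to each arrow of \<open>\<^bold>A\<^sub>n\<close> the signed number of associativity moves it
  consists of, a move with blocks of sizes i, j, k being counted with weight \<open>w i j k\<close>.\<close>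

definition weighting :: "(nat \<Rightarrow> nat \<Rightarrow> nat \<Rightarrow> 'a::ab_group_add) \<Rightarrow> nat \<Rightarrow> (nat \<Rightarrow> nat \<Rightarrow> 'a) \<Rightarrow> bool"
  where "weighting w n \<phi> \<longleftrightarrow> cat_functor (A_cat n) add_cat (add_ftr (\<phi> n)) \<and>
    (\<forall>x\<in>Arr (pair_cat n A_cat). \<phi> n (ar (st_U (stage {1..} n)) x) = pair_weight \<phi> x) \<and>
    (\<forall>x\<in>Arr (D_of {1..} n A_cat). \<phi> n (ar (st_V (stage {1..} n)) x) = triple_weight w \<phi> x)"

text \<open>The blocks of a pair or triple of total size n are smaller than n, so changing \<phi> at
  larger sizes has no effect.\<close>

lemma weighting_cong:
  assumes "\<And>m. 1 \<le> m \<Longrightarrow> m \<le> n \<Longrightarrow> \<phi> m = \<psi> m" "1 \<le> n" "weighting w n \<phi>"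
  shows "weighting w n \<psi>"
proof -
  have "pair_weight \<phi> x = pair_weight \<psi> x" if "x \<in> Arr (pair_cat n A_cat)" for x
    using that assms(1) by (cases x) (auto simp: pair_weight_def pair_carr pairs_def)
  moreover have "triple_weight w \<phi> x = triple_weight w \<psi> x" if "x \<in> Arr (D_of {1..} n A_cat)" for x
    using that assms(1) by (cases x) (auto simp: triple_weight_def triple_carr triples_def)
  ultimately show ?thesis using assms by (simp add: weighting_def)
qed

text \<open>The weights on the two corners of the pushout form a cone for every choice of
  \<open>w\<close>, so they glue to an additive functor on the next stage.\<close>

lemma weighting_extend:
  assumes n: "2 \<le> n" and wt: "\<And>m. 1 \<le> m \<Longrightarrow> m < n \<Longrightarrow> weighting w m \<phi>"
  shows "\<exists>F. weighting w n (\<phi>(n := F))"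
proof -
  interpret catalan_stage "{1..}" n by (rule catalan_stageI[OF n])
  have f: "cat_functor (A_cat m) add_cat (add_ftr (\<phi> m))" if "1 \<le> m" "m < n" for m
    using wt[OF that] by (simp add: weighting_def)
  then have id: "\<phi> m (Id (A_cat m) x) = 0" if "1 \<le> m" "m < n" "x \<in> Obj (A_cat m)" for m x
    using that by (auto simp: add_functor_iff)
  from f have comp: "\<phi> m (Comp (A_cat m) h g) = \<phi> m h + \<phi> m g"
    if "1 \<le> m" "m < n" "g \<in> Arr (A_cat m)" "h \<in> Arr (A_cat m)" "Cod (A_cat m) g = Dom (A_cat m) h" for m g h
    using that by (auto simp: add_functor_iff)
  have U: "\<phi> (a + b) (ar (U_of (stage {1..}) a b) (g, h)) = \<phi> a g + \<phi> b h"
    if "1 \<le> a" "1 \<le> b" "a + b < n" "g \<in> Arr (A_cat a)" "h \<in> Arr (A_cat b)" for a b g h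
  proof -
    have "((a, b), (g, h)) \<in> Arr (pair_cat (a + b) A_cat)"
      using that by (simp add: pair_carr pairs_def)
    then show ?thesis using wt[of "a + b"] that
      by (auto simp: weighting_def U_of_def pair_weight_def)
  qed
  have H: "cat_functor (D_of {1..} n A_cat) add_cat (add_ftr (triple_weight w \<phi>))"
    using V_functor[folded A_cat_def, unfolded cat_functor_def]
    by (auto simp: add_functor_iff triple_carr triple_ops triple_weight_def id comp triples_def
        indiscrete_def)
  have K: "cat_functor (pair_cat n A_cat) add_cat (add_ftr (pair_weight \<phi>))"
    using U_functor[folded A_cat_def, unfolded cat_functor_def]
    by (auto simp: add_functor_iff pair_carr pair_ops pair_weight_def id comp pairs_def)
  \<comment> \<open>On the discrete part t = t', so \<open>w\<close> does not enter, and what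
    remains is additivity of \<phi> over the smaller functors U.\<close>
  have cone: "eq_ftr_on (C_of {1..} n A_cat) (comp_ftr (add_ftr (triple_weight w \<phi>)) id_ftr)
      (comp_ftr (add_ftr (pair_weight \<phi>)) W)"
    by (auto simp: comp_add_ftr eq_add_ftr triple_carr triple_weight_def pair_weight_def id_ftr_def
        W_ftr_def discrete_def triples_def U[simplified])
  obtain M where M: "cat_functor (A_cat n) add_cat M"
    "eq_ftr_on (D_of {1..} n A_cat) (comp_ftr M (st_V (stage {1..} n))) (add_ftr (triple_weight w \<phi>))"
    "eq_ftr_on (pair_cat n A_cat) (comp_ftr M (st_U (stage {1..} n))) (add_ftr (pair_weight \<phi>))"
    using A_univ[folded A_cat_def, OF H K cone] by blast
  have "pair_weight (\<phi>(n := ar M)) x = pair_weight \<phi> x" if "x \<in> Arr (pair_cat n A_cat)" for x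
    using that by (cases x) (auto simp: pair_weight_def pair_carr pairs_def)
  moreover have "triple_weight w (\<phi>(n := ar M)) x = triple_weight w \<phi> x"
    if "x \<in> Arr (D_of {1..} n A_cat)" for x
    using that by (cases x) (auto simp: triple_weight_def triple_carr triples_def)
  ultimately have "weighting w n (\<phi>(n := ar M))"
    using M by (simp add: weighting_def add_ftr_ar) (simp add: eq_ftr_on_def comp_ftr_def add_ftr_def)
  then show ?thesis by (rule exI[of _ "ar M"])
qed

lemma weighting_exists: "\<exists>\<phi>. \<forall>m. 1 \<le> m \<longrightarrow> m \<le> n \<longrightarrow> weighting w m \<phi>"
proof (induction n)
  case (Suc n)
  then obtain \<phi> where \<phi>: "\<And>m. 1 \<le> m \<Longrightarrow> m \<le> n \<Longrightarrow> weighting w m \<phi>" by auto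
  have "\<exists>F. weighting w (Suc n) (\<phi>(Suc n := F))"
  proof (cases "n = 0")
    case True
    \<comment> \<open>No positive sizes add up to 1 in two or three blocks, so the conditions on U
      and V are vacuous at this stage.\<close>
    have "weighting w 1 (\<lambda>_ _. 0)"
      using one_groupoid
      by (auto simp: weighting_def T1[simplified] add_functor_iff pair_carr triple_carr pairs_def triples_def groupoid_def)
    then have "weighting w 1 (\<phi>(1 := \<lambda>_. 0))" by (rule weighting_cong[rotated 2]) auto
    then show ?thesis using True by auto
  next
    case False
    then show ?thesis using \<phi> by (intro weighting_extend) auto
  qed
  then obtain F where F: "weighting w (Suc n) (\<phi>(Suc n := F))" ..
  have "weighting w m (\<phi>(Suc n := F))" if "1 \<le> m" "m \<le> Suc n" for m
  proof (cases "m = Suc n")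
    case False
    with that have "m \<le> n" by simp
    then show ?thesis by (intro weighting_cong[OF _ that(1) \<phi>[OF that(1)]]) auto
  qed (use F in simp)
  then show ?case by blast
qed simp

section \<open>Weights on the indiscrete subgroupoids\<close>

lemma L_ftr_structure:
  assumes n: "2 \<le> n"
  shows "eq_ftr_on (D_of {1} n T_cat) (comp_ftr (L_ftr n) (st_V (stage {1} n)))
      (comp_ftr (st_V (stage {1..} n)) (triple_ftr L_ftr))"
    and "eq_ftr_on (pair_cat n T_cat) (comp_ftr (L_ftr n) (st_U (stage {1} n)))
      (comp_ftr (st_U (stage {1..} n)) (pair_ftr L_ftr))"
proof -
  interpret T: catalan_stage "{1}" n by (rule catalan_stageI[OF n])
  interpret A: catalan_stage "{1..}" n by (rule catalan_stageI[OF n])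
  have L: "cat_functor (T_cat m) (A_cat m) (L_ftr m)" if "1 \<le> m" for m
    using L_ok[OF that] by (simp add: L_ok_def)
  note La = L[THEN cat_functor.ob_in] L[THEN cat_functor.ar_in] L[THEN cat_functor.dom_ar]
    L[THEN cat_functor.cod_ar] L[THEN cat_functor.ar_id] L[THEN cat_functor.ar_comp]
  note cats = T.V_functor[folded T_cat_def] A.V_functor[folded A_cat_def]
    T.U_functor[folded T_cat_def] A.U_functor[folded A_cat_def]
  have H: "cat_functor (D_of {1} n T_cat) (A_cat n) (comp_ftr (st_V (stage {1..} n)) (triple_ftr L_ftr))"
  proof (rule comp_functor[OF _ cats(2)], intro cat_functor.intro cat_functor_axioms.intro)
    show "category (D_of {1} n T_cat)" "category (D_of {1..} n A_cat)"
      using cats by (simp_all add: cat_functor_def)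
  qed (auto simp: triple_ftr_def triple_carr triple_ops La triples_def)
  have K: "cat_functor (pair_cat n T_cat) (A_cat n) (comp_ftr (st_U (stage {1..} n)) (pair_ftr L_ftr))"
  proof (rule comp_functor[OF _ cats(4)], intro cat_functor.intro cat_functor_axioms.intro)
    show "category (pair_cat n T_cat)" "category (pair_cat n A_cat)"
      using cats by (simp_all add: cat_functor_def)
  qed (auto simp: pair_ftr_def pair_carr pair_ops La pairs_def)
  have UL_eq: "eq_ftr_on (prod_cat (T_cat a) (T_cat b)) (comp_ftr (L_ftr (a + b)) (U_of (stage {1}) a b))
      (comp_ftr (U_of (stage {1..}) a b) \<lparr>ob = map_prod (ob (L_ftr a)) (ob (L_ftr b)), ar = map_prod (ar (L_ftr a)) (ar (L_ftr b))\<rparr>)"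
    if "1 \<le> a" "1 \<le> b" for a b
    using L_ok[of "a + b"] that by (simp add: L_ok_def)
  have UL: "ob (L_ftr (a + b)) (ob (U_of (stage {1}) a b) (x, y))
      = ob (U_of (stage {1..}) a b) (ob (L_ftr a) x, ob (L_ftr b) y)"
    if "1 \<le> a" "1 \<le> b" "x \<in> Obj (T_cat a)" "y \<in> Obj (T_cat b)" for a b x y
    using UL_eq[OF that(1,2)] that(3,4) by (auto simp: eq_ftr_on_def comp_ftr_def prod_cat_def)
  have UL': "ar (L_ftr (a + b)) (ar (U_of (stage {1}) a b) (f, g))
      = ar (U_of (stage {1..}) a b) (ar (L_ftr a) f, ar (L_ftr b) g)"
    if "1 \<le> a" "1 \<le> b" "f \<in> Arr (T_cat a)" "g \<in> Arr (T_cat b)" for a b f g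
    using UL_eq[OF that(1,2)] that(3,4) by (auto simp: eq_ftr_on_def comp_ftr_def prod_cat_def)
  have tri: "ob (triple_ftr L_ftr) x \<in> Obj (C_of {1..} n A_cat)
      \<and> ob A.W (ob (triple_ftr L_ftr) x) = ob (pair_ftr L_ftr) (ob T.W x)"
    if "x \<in> Obj (C_of {1} n T_cat)" for x
    using that by (cases x)
      (auto simp: triple_ftr_def pair_ftr_def W_ftr_def triple_carr La triples_def discrete_def simp flip: UL[simplified])
  have tri': "ar (triple_ftr L_ftr) x \<in> Arr (C_of {1..} n A_cat)
      \<and> ar A.W (ar (triple_ftr L_ftr) x) = ar (pair_ftr L_ftr) (ar T.W x)"
    if "x \<in> Arr (C_of {1} n T_cat)" for x
    using that by (cases x)
      (auto simp: triple_ftr_def pair_ftr_def W_ftr_def triple_carr La triples_def discrete_def simp flip: UL'[simplified])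
  have cone: "eq_ftr_on (C_of {1} n T_cat)
      (comp_ftr (comp_ftr (st_V (stage {1..} n)) (triple_ftr L_ftr)) id_ftr)
      (comp_ftr (comp_ftr (st_U (stage {1..} n)) (pair_ftr L_ftr)) T.W)"
    using A.VU[folded A_cat_def] tri tri' by (simp add: eq_ftr_on_def comp_ftr_def id_ftr_def)
  \<comment> \<open>\<open>L_ftr n\<close> is a \<open>SOME\<close> choice; its compatibility with
    both structure functors follows because the universal property shows that a choice
    exists.\<close>
  have "cat_functor (T_cat n) (A_cat n) (L_ftr n)
    \<and> eq_ftr_on (D_of {1} n T_cat) (comp_ftr (L_ftr n) (st_V (stage {1} n)))
        (comp_ftr (st_V (stage {1..} n)) (triple_ftr L_ftr))
    \<and> eq_ftr_on (pair_cat n T_cat) (comp_ftr (L_ftr n) (st_U (stage {1} n)))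
        (comp_ftr (st_U (stage {1..} n)) (pair_ftr L_ftr))"
    unfolding L_rec[OF n] next_L_def induced_ftr_def
    by (rule someI_ex) (use T.A_univ[folded T_cat_def, OF H K cone] in blast)
  then show "eq_ftr_on (D_of {1} n T_cat) (comp_ftr (L_ftr n) (st_V (stage {1} n)))
      (comp_ftr (st_V (stage {1..} n)) (triple_ftr L_ftr))"
    "eq_ftr_on (pair_cat n T_cat) (comp_ftr (L_ftr n) (st_U (stage {1} n)))
      (comp_ftr (st_U (stage {1..} n)) (pair_ftr L_ftr))" by auto
qed

text \<open>If the moves with \<open>j = 1\<close> have weight 0, then \<open>\<phi> n \<circ> L\<^sub>n\<close> and the zero functor solve the same
  universal problem.\<close>

lemma weighting_vanishes_on_T:
  assumes w: "\<And>i k. w i 1 k = 0" and \<phi>: "\<And>m. 1 \<le> m \<Longrightarrow> m \<le> n \<Longrightarrow> weighting w m \<phi>"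
    and n: "1 \<le> n" "f \<in> Arr (T_cat n)"
  shows "\<phi> n (ar (L_ftr n) f) = 0"
  using n(2) \<phi> n(1)
proof (induction n arbitrary: f rule: less_induct)
  case (less n)
  note \<phi> = less.prems(2)
  show ?case
  proof (cases "n = 1")
    case True
    have "weighting w 1 \<phi>" using \<phi> True by auto
    then show ?thesis using True less.prems(1)
      by (auto simp: L_1[simplified] T1[simplified] id_ftr_def weighting_def add_functor_iff one_cat_def)
  next
    case False
    then have n: "2 \<le> n" using less.prems by simp
    interpret T: catalan_stage "{1}" n by (rule catalan_stageI[OF n])
    have L: "cat_functor (T_cat m) (A_cat m) (L_ftr m)" if "1 \<le> m" for m
      using L_ok[OF that] by (simp add: L_ok_def)
    have IH: "\<phi> m (ar (L_ftr m) f) = 0" if "1 \<le> m" "m < n" "f \<in> Arr (T_cat m)" for m f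
      using less.IH[OF that(2,3) \<phi>] that by auto
    have wn: "weighting w n \<phi>" using \<phi> n by auto
    have 0: "cat_functor C add_cat (add_ftr (\<lambda>_. 0 :: 'a))" if "category C" for C :: "('x, 'y) cat"
      using that by (simp add: add_functor_iff)
    have pr: "ar (pair_ftr L_ftr) x \<in> Arr (pair_cat n A_cat) \<and> pair_weight \<phi> (ar (pair_ftr L_ftr) x) = 0"
      if "x \<in> Arr (pair_cat n T_cat)" for x
      using that by (cases x)
        (auto simp: pair_ftr_def pair_carr pairs_def pair_weight_def IH L[THEN cat_functor.ar_in])
    \<comment> \<open>Triples for \<open>T_cat\<close> have j = 1, so their moves have weight 0 by
      \<open>w\<close>, and the three components have weight 0 by induction.\<close>
    have tr: "ar (triple_ftr L_ftr) x \<in> Arr (D_of {1..} n A_cat)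
        \<and> triple_weight w \<phi> (ar (triple_ftr L_ftr) x) = 0"
      if "x \<in> Arr (D_of {1} n T_cat)" for x
      using that w by (cases x)
        (auto simp: triple_ftr_def triple_carr triples_def triple_weight_def IH L[THEN cat_functor.ar_in])
    let ?M = "comp_ftr (add_ftr (\<phi> n)) (L_ftr n)"
    have M: "cat_functor (T_cat n) add_cat ?M"
      by (rule comp_functor[OF L]) (use n wn in \<open>auto simp: weighting_def\<close>)
    have MV: "eq_ftr_on (D_of {1} n T_cat) (comp_ftr ?M (st_V (stage {1} n))) (add_ftr (\<lambda>_. 0))"
      and MU: "eq_ftr_on (pair_cat n T_cat) (comp_ftr ?M (st_U (stage {1} n))) (add_ftr (\<lambda>_. 0))"
      using L_ftr_structure[OF n] wn tr pr
      by (simp_all add: eq_ftr_on_def comp_ftr_def add_ftr_def weighting_def)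
    have Z: "eq_ftr_on C (comp_ftr (add_ftr (\<lambda>_. 0 :: 'a)) F) (add_ftr (\<lambda>_. 0 :: 'a))"
      for C :: "('x, 'y) cat" and F :: "('x, 'y, nat, nat) ftr"
      by (simp add: comp_add_ftr eq_add_ftr)
    have cone: "eq_ftr_on (C_of {1} n T_cat) (comp_ftr (add_ftr (\<lambda>_. 0 :: 'a)) id_ftr) (comp_ftr (add_ftr (\<lambda>_. 0 :: 'a)) T.W)"
      by (simp add: comp_add_ftr eq_add_ftr)
    have cats: "category (D_of {1} n T_cat)" "category (pair_cat n T_cat)" "category (T_cat n)"
      using T.V_functor[folded T_cat_def] T.U_functor[folded T_cat_def] by (simp_all add: cat_functor_def)
    obtain N where N: "\<And>M'. cat_functor (T_cat n) add_cat M'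
        \<Longrightarrow> eq_ftr_on (D_of {1} n T_cat) (comp_ftr M' (st_V (stage {1} n))) (add_ftr (\<lambda>_. 0 :: 'a))
        \<Longrightarrow> eq_ftr_on (pair_cat n T_cat) (comp_ftr M' (st_U (stage {1} n))) (add_ftr (\<lambda>_. 0 :: 'a))
        \<Longrightarrow> eq_ftr_on (T_cat n) M' N"
      using T.A_univ[folded T_cat_def, OF 0[OF cats(1)] 0[OF cats(2)] cone] by blast
    have "eq_ftr_on (T_cat n) ?M N" "eq_ftr_on (T_cat n) (add_ftr (\<lambda>_. 0 :: 'a)) N"
      using N[OF M MV MU] N[OF 0[OF cats(3)] Z Z] by auto
    then show ?thesis using less.prems(1) by (simp add: eq_ftr_on_def comp_ftr_def add_ftr_def)
  qed
qed

section \<open>Passage to the fundamental group\<close>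

lemma pi_A_carrier: "carrier (pi_A n) = Arr (pushout (T_cat n) one_cat (A_cat n) to_one (L_ftr n))"
  "mult (pi_A n) = Comp (pushout (T_cat n) one_cat (A_cat n) to_one (L_ftr n))"
  by (simp_all add: pi_A_def monoid_of_def)

lemma pi_A_pushout:
  assumes "1 \<le> n"
  shows "pushout_square (T_cat n) one_cat (A_cat n) to_one (L_ftr n)"
  using L_ok[OF assms]
  by (intro pushout_square.intro to_one_functor) (simp_all add: L_ok_def cat_functor_def)

text \<open>Vanishing on the image of \<open>L_ftr n\<close> says that \<phi> and the zero functor
  on the trivial category form a cone over the pushout defining \<open>pi_A n\<close>.\<close>

lemma pi_A_additive:
  fixes \<phi> :: "nat \<Rightarrow> 'a::ab_group_add"
  assumes n: "1 \<le> n" and \<phi>: "cat_functor (A_cat n) add_cat (add_ftr \<phi>)"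
    and van: "\<And>f. f \<in> Arr (T_cat n) \<Longrightarrow> \<phi> (ar (L_ftr n) f) = 0"
  shows "\<exists>\<psi>. (\<forall>x\<in>carrier (pi_A n). \<forall>y\<in>carrier (pi_A n). \<psi> (x \<otimes>\<^bsub>pi_A n\<^esub> y) = \<psi> x + \<psi> y)
    \<and> (\<forall>f\<in>Arr (A_cat n). \<psi> (ar (pushout_right (T_cat n) one_cat (A_cat n) to_one (L_ftr n)) f) = \<phi> f)"
proof -
  interpret pushout_square "T_cat n" one_cat "A_cat n" to_one "L_ftr n"
    by (rule pi_A_pushout[OF n])
  have "cat_functor one_cat add_cat (add_ftr (\<lambda>_. 0 :: 'a))"
    using one_groupoid by (simp add: add_functor_iff groupoid_def)
  moreover have "eq_ftr_on (T_cat n) (comp_ftr (add_ftr (\<lambda>_. 0)) to_one) (comp_ftr (add_ftr \<phi>) (L_ftr n))"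
    by (simp add: comp_add_ftr eq_add_ftr van)
  ultimately obtain M where M: "cat_functor Po add_cat M" "eq_ftr_on (A_cat n) (comp_ftr M inE) (add_ftr \<phi>)"
    using Po_univ[OF _ \<phi>] by blast
  obtain X where "Obj Po = {X}" using pi_group(2)[OF n] by auto
  \<comment> \<open>With a single object all arrows are composable, so functoriality becomes a
    homomorphism property.\<close>
  then have "Cod Po x = X" "Dom Po x = X" if "x \<in> Arr Po" for x
    using that category.dom_obj[OF Po_category] category.cod_obj[OF Po_category] by auto
  moreover have "cat_functor Po add_cat (add_ftr (ar M))" using M by (simp add: add_ftr_ar)
  ultimately have "ar M (Comp Po x y) = ar M x + ar M y" if "x \<in> Arr Po" "y \<in> Arr Po" for x y
    using that by (auto simp: add_functor_iff)
  then show ?thesis using M(2)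
    by (intro exI[of _ "ar M"]) (auto simp: pi_A_carrier eq_ftr_on_def comp_ftr_def add_ftr_def)
qed

section \<open>Pentagons\<close>

text \<open>Conjugacy of loops that remembers the weight c of the conjugating arrow. A chain of
  conjugacies from f back to f thus gives a loop commuting with f whose weight is the sum along the
  chain.\<close>

definition conj_by :: "('o, 'm) cat \<Rightarrow> ('m \<Rightarrow> 'a) \<Rightarrow> 'a \<Rightarrow> 'm \<Rightarrow> 'm \<Rightarrow> bool"
  where "conj_by C \<phi> c f g \<longleftrightarrow> f \<in> Arr C \<and> g \<in> Arr C \<and> Dom C f = Cod C f \<and> Dom C g = Cod C g \<and>
    (\<exists>u\<in>Arr C. Dom C u = Dom C f \<and> Cod C u = Dom C g \<and> Comp C g u = Comp C u f \<and> \<phi> u = c)"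

locale additive_groupoid = groupoid C for C :: "('o, 'm) cat" +
  fixes \<phi> :: "'m \<Rightarrow> 'a::ab_group_add"
  assumes additive: "cat_functor C add_cat (add_ftr \<phi>)"
begin

lemma \<phi>_id: "x \<in> Obj C \<Longrightarrow> \<phi> (Id C x) = 0"
  using additive by (simp add: add_functor_iff)

lemma \<phi>_comp: "\<lbrakk>f \<in> Arr C; g \<in> Arr C; Cod C f = Dom C g\<rbrakk> \<Longrightarrow> \<phi> (Comp C g f) = \<phi> g + \<phi> f"
  using additive by (simp add: add_functor_iff)

lemma conj_by_refl:
  assumes "f \<in> Arr C" "Dom C f = Cod C f"
  shows "conj_by C \<phi> 0 f f"
proof -
  have "Comp C f (Id C (Dom C f)) = Comp C (Id C (Dom C f)) f"
    using comp_id id_comp assms by metis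
  then show ?thesis unfolding conj_by_def
    using assms cod_obj by (intro conjI bexI[of _ "Id C (Dom C f)"]) (auto simp: id_arr dom_id cod_id \<phi>_id)
qed

lemma conj_by_trans:
  assumes "conj_by C \<phi> c f g" "conj_by C \<phi> d g h"
  shows "conj_by C \<phi> (d + c) f h"
proof -
  have l: "f \<in> Arr C" "g \<in> Arr C" "h \<in> Arr C" "Dom C f = Cod C f" "Dom C g = Cod C g" "Dom C h = Cod C h"
    using assms by (auto simp: conj_by_def)
  obtain u where u: "u \<in> Arr C" "Dom C u = Dom C f" "Cod C u = Dom C g" "Comp C g u = Comp C u f" "\<phi> u = c"
    using assms(1) by (auto simp: conj_by_def)
  obtain v where v: "v \<in> Arr C" "Dom C v = Dom C g" "Cod C v = Dom C h" "Comp C h v = Comp C v g" "\<phi> v = d"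
    using assms(2) by (auto simp: conj_by_def)
  have "Comp C h (Comp C v u) = Comp C (Comp C v g) u" using u v l by (simp add: comp_assoc)
  also have "\<dots> = Comp C v (Comp C u f)" using u v l by (simp flip: comp_assoc)
  also have "\<dots> = Comp C (Comp C v u) f" using u v l by (simp add: comp_assoc)
  finally have "Comp C h (Comp C v u) = Comp C (Comp C v u) f" .
  then show ?thesis unfolding conj_by_def using u v l
    by (intro conjI bexI[of _ "Comp C v u"]) (auto simp: comp_arr dom_comp cod_comp \<phi>_comp)
qed

lemma conj_by_sym:
  assumes "conj_by C \<phi> c f g"
  shows "conj_by C \<phi> (- c) g f"
proof -
  have l: "f \<in> Arr C" "g \<in> Arr C" "Dom C f = Cod C f" "Dom C g = Cod C g"
    using assms by (auto simp: conj_by_def)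
  obtain u where u: "u \<in> Arr C" "Dom C u = Dom C f" "Cod C u = Dom C g" "Comp C g u = Comp C u f" "\<phi> u = c"
    using assms by (auto simp: conj_by_def)
  obtain v where v: "v \<in> Arr C" "Dom C v = Cod C u" "Cod C v = Dom C u"
    "Comp C v u = Id C (Dom C u)" "Comp C u v = Id C (Cod C u)"
    using inverse[OF u(1)] by auto
  have "Comp C f v = Comp C (Comp C (Comp C v u) f) v"
    using id_comp[OF l(1)] u v l by simp
  also have "\<dots> = Comp C (Comp C v (Comp C u f)) v" using u v l by (simp add: comp_assoc)
  also have "\<dots> = Comp C (Comp C v (Comp C g u)) v" using u by simp
  also have "\<dots> = Comp C v (Comp C g (Comp C u v))"
    using u(1-3) v(1-3) l by (simp add: comp_assoc comp_arr dom_comp cod_comp)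
  also have "\<dots> = Comp C v g" using comp_id[OF l(2)] u v l by simp
  finally have "Comp C f v = Comp C v g" .
  moreover have "\<phi> v + \<phi> u = 0" using \<phi>_comp[of u v] \<phi>_id[OF dom_obj[OF u(1)]] u v by simp
  ultimately show ?thesis unfolding conj_by_def using u v l
    by (intro conjI bexI[of _ v]) (auto simp: eq_neg_iff_add_eq_0)
qed

end

section \<open>Products of loops and associativity moves\<close>

abbreviation tensor :: "nat \<Rightarrow> nat \<Rightarrow> nat \<Rightarrow> nat \<Rightarrow> nat"
  where "tensor a b f g \<equiv> ar (U_of (stage {1..}) a b) (f, g)"

abbreviation loop :: "nat \<Rightarrow> nat \<Rightarrow> bool"
  where "loop n f \<equiv> f \<in> Arr (A_cat n) \<and> Dom (A_cat n) f = Cod (A_cat n) f"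

locale weighted_catalan =
  fixes w :: "nat \<Rightarrow> nat \<Rightarrow> nat \<Rightarrow> 'a::ab_group_add" and \<phi> :: "nat \<Rightarrow> nat \<Rightarrow> 'a" and n :: nat
  assumes wt: "\<And>m. 1 \<le> m \<Longrightarrow> m \<le> n \<Longrightarrow> weighting w m \<phi>"
begin

lemma additive_groupoid: "1 \<le> m \<Longrightarrow> m \<le> n \<Longrightarrow> additive_groupoid (A_cat m) (\<phi> m)"
  using stage_ok[of m "{1..}"] wt[of m]
  by (simp add: additive_groupoid_def additive_groupoid_axioms_def stage_ok_def weighting_def A_cat_def)

lemma U_functor:
  "1 \<le> a \<Longrightarrow> 1 \<le> b \<Longrightarrow> cat_functor (prod_cat (A_cat a) (A_cat b)) (A_cat (a + b)) (U_of (stage {1..}) a b)"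
  using stage_ok[of "a + b" "{1..}"] by (simp add: stage_ok_def A_cat_def)

lemma weight_tensor:
  assumes "1 \<le> a" "1 \<le> b" "a + b \<le> n" "f \<in> Arr (A_cat a)" "g \<in> Arr (A_cat b)"
  shows "\<phi> (a + b) (tensor a b f g) = \<phi> a f + \<phi> b g"
proof -
  have "((a, b), (f, g)) \<in> Arr (pair_cat (a + b) A_cat)" using assms by (simp add: pair_carr pairs_def)
  then show ?thesis using wt[of "a + b"] assms by (auto simp: weighting_def pair_weight_def U_of_def)
qed

lemma loop_tensor:
  assumes "1 \<le> a" "1 \<le> b" "loop a f" "loop b g"
  shows "loop (a + b) (tensor a b f g)"
proof -
  interpret U: cat_functor "prod_cat (A_cat a) (A_cat b)" "A_cat (a + b)" "U_of (stage {1..}) a b"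
    by (rule U_functor) fact+
  show ?thesis using assms U.ar_in[of "(f, g)"] U.dom_ar[of "(f, g)"] U.cod_ar[of "(f, g)"]
    by (simp add: prod_cat_def)
qed

lemma conj_by_tensor:
  assumes ab: "1 \<le> a" "1 \<le> b" "a + b \<le> n"
    and f: "conj_by (A_cat a) (\<phi> a) c f f'" and g: "conj_by (A_cat b) (\<phi> b) d g g'"
  shows "conj_by (A_cat (a + b)) (\<phi> (a + b)) (c + d) (tensor a b f g) (tensor a b f' g')"
proof -
  interpret U: cat_functor "prod_cat (A_cat a) (A_cat b)" "A_cat (a + b)" "U_of (stage {1..}) a b"
    by (rule U_functor) fact+
  have l: "loop a f" "loop a f'" "loop b g" "loop b g'"
    using f g by (auto simp: conj_by_def)
  obtain u where u: "u \<in> Arr (A_cat a)" "Dom (A_cat a) u = Dom (A_cat a) f" "Cod (A_cat a) u = Dom (A_cat a) f'"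
    "Comp (A_cat a) f' u = Comp (A_cat a) u f" "\<phi> a u = c"
    using f by (auto simp: conj_by_def)
  obtain v where v: "v \<in> Arr (A_cat b)" "Dom (A_cat b) v = Dom (A_cat b) g" "Cod (A_cat b) v = Dom (A_cat b) g'"
    "Comp (A_cat b) g' v = Comp (A_cat b) v g" "\<phi> b v = d"
    using g by (auto simp: conj_by_def)
  note uv = U.ar_in[of "(u, v)"] U.dom_ar[of "(u, v)"] U.cod_ar[of "(u, v)"]
    U.dom_ar[of "(f, g)"] U.dom_ar[of "(f', g')"]
    U.ar_comp[of "(u, v)" "(f', g')"] U.ar_comp[of "(f, g)" "(u, v)"]
  show ?thesis unfolding conj_by_def
    using loop_tensor[OF ab(1,2) l(1,3)] loop_tensor[OF ab(1,2) l(2,4)] uv u v l weight_tensor[OF ab u(1) v(1)]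
    by (intro conjI bexI[of _ "tensor a b u v"]) (simp_all add: prod_cat_def)
qed

text \<open>This is naturality of the associativity move in its three blocks; the conjugating arrow
  is the move itself, of weight \<open>w i j k\<close>.\<close>

lemma conj_by_assoc:
  assumes ijk: "1 \<le> i" "1 \<le> j" "1 \<le> k" "i + j + k \<le> n" and l: "loop i f" "loop j g" "loop k h"
  shows "conj_by (A_cat (i + j + k)) (\<phi> (i + j + k)) (w i j k)
    (tensor i (j + k) f (tensor j k g h)) (tensor (i + j) k (tensor i j f g) h)"
proof -
  let ?N = "i + j + k"
  interpret S: catalan_stage "{1..}" ?N by (rule catalan_stageI) (use ijk in simp)
  note VU = S.VU[folded A_cat_def]
  interpret V: cat_functor "D_of {1..} ?N A_cat" "A_cat ?N" "st_V (stage {1..} ?N)"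
    using S.V_functor[folded A_cat_def] .
  let ?V = "\<lambda>f g h u. ar (st_V (stage {1..} ?N)) ((i, j, k), (f, g, h, u))"
  have t: "(i, j, k) \<in> triples {1..} ?N" using ijk by (simp add: triples_def)
  have C: "((i, j, k), (f, g, h, (s, s))) \<in> Arr (C_of {1..} ?N A_cat)" if "s = 0 \<or> s = 1" for s
    using t l that by (auto simp: triple_carr discrete_def)
  \<comment> \<open>The pushout relation identifies the ends 0 and 1 of the move with the two
    bracketings.\<close>
  have V0: "?V f g h (0, 0) = tensor i (j + k) f (tensor j k g h)"
    using VU C[of 0] by (simp add: eq_ftr_on_def comp_ftr_def id_ftr_def W_ftr_def U_of_def add.assoc)
  have V1: "?V f g h (1, 1) = tensor (i + j) k (tensor i j f g) h"
    using VU C[of 1] by (simp add: eq_ftr_on_def comp_ftr_def id_ftr_def W_ftr_def U_of_def)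
  let ?x = "Id (A_cat i) (Dom (A_cat i) f)" and ?y = "Id (A_cat j) (Dom (A_cat j) g)"
    and ?z = "Id (A_cat k) (Dom (A_cat k) h)"
  have cat: "category (A_cat i)" "category (A_cat j)" "category (A_cat k)"
    using stage_ok[of _ "{1..}"] ijk by (auto simp: stage_ok_def groupoid_def A_cat_def)
  note id = cat[THEN category.id_arr] cat[THEN category.dom_id] cat[THEN category.cod_id]
    cat[THEN category.dom_obj] cat[THEN category.cod_obj]
  have D: "((i, j, k), (f, g, h, (s, s))) \<in> Arr (D_of {1..} ?N A_cat)" if "s = 0 \<or> s = 1" for s
    using t l that by (auto simp: triple_carr indiscrete_def)
  have E: "((i, j, k), (?x, ?y, ?z, (0, 1))) \<in> Arr (D_of {1..} ?N A_cat)"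
    using t l id by (simp add: triple_carr indiscrete_def)
  \<comment> \<open>Both composites are (f, g, h) together with the arrow from 0 to 1. The same
    identities serve at both ends because f, g and h are loops.\<close>
  have eq: "Comp (D_of {1..} ?N A_cat) ((i, j, k), (f, g, h, (1, 1))) ((i, j, k), (?x, ?y, ?z, (0, 1)))
      = Comp (D_of {1..} ?N A_cat) ((i, j, k), (?x, ?y, ?z, (0, 1))) ((i, j, k), (f, g, h, (0, 0)))"
    using t l cat[THEN category.comp_id] cat[THEN category.id_comp]
    by (simp add: triple_ops indiscrete_def) metis
  have "Comp (A_cat ?N) (?V f g h (1, 1)) (?V ?x ?y ?z (0, 1)) = Comp (A_cat ?N) (?V ?x ?y ?z (0, 1)) (?V f g h (0, 0))"
    using V.ar_comp[OF E D[of 1]] V.ar_comp[OF D[of 0] E] eq t l id by (simp add: triple_ops indiscrete_def)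
  moreover have "\<phi> ?N (?V ?x ?y ?z (0, 1)) = w i j k"
  proof -
    have "\<phi> i ?x = 0" "\<phi> j ?y = 0" "\<phi> k ?z = 0"
      using additive_groupoid[THEN additive_groupoid.\<phi>_id] ijk l id by auto
    then show ?thesis using wt[of ?N] E ijk by (simp add: weighting_def triple_weight_def)
  qed
  ultimately show ?thesis unfolding conj_by_def V0[symmetric] V1[symmetric]
    using V.ar_in[OF E] V.ar_in[OF D] V.dom_ar[OF E] V.cod_ar[OF E] V.dom_ar[OF D] V.cod_ar[OF D] t l id
    by (intro conjI bexI[of _ "?V ?x ?y ?z (0, 1)"]) (simp_all add: triple_ops indiscrete_def)
qed

text \<open>Going around the pentagon of bracketings of four factors is natural in the factors, hence
  commutes with every product of loops.\<close>

lemma conj_by_pentagon: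
  assumes 1: "1 \<le> p" "1 \<le> q" "1 \<le> r" "1 \<le> s" and N: "N = p + q + r + s" "N \<le> n"
    and l: "loop p f" "loop q g" "loop r h" "loop s e"
    and F: "F = tensor p (q + r + s) f (tensor q (r + s) g (tensor r s h e))"
  shows "conj_by (A_cat N) (\<phi> N) (w q r s + w p (q + r) s + w p q r - w (p + q) r s - w p q (r + s)) F F"
proof -
  interpret additive_groupoid "A_cat N" "\<phi> N" using 1 N by (intro additive_groupoid) auto
  have refl: "conj_by (A_cat m) (\<phi> m) 0 g g" if "loop m g" "1 \<le> m" "m \<le> n" for m g
    using that additive_groupoid.conj_by_refl[OF additive_groupoid] by blast
  \<comment> \<open>Together with \<open>F\<close> these are the five bracketings, listed in the
    order in which the pentagon is traversed.\<close>
  let ?G1 = "tensor p (q + r + s) f (tensor (q + r) s (tensor q r g h) e)"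
  let ?G2 = "tensor (p + (q + r)) s (tensor p (q + r) f (tensor q r g h)) e"
  let ?G3 = "tensor (p + q + r) s (tensor (p + q) r (tensor p q f g) h) e"
  let ?G4 = "tensor (p + q) (r + s) (tensor p q f g) (tensor r s h e)"
  have "conj_by (A_cat (p + (q + r + s))) (\<phi> (p + (q + r + s))) (0 + w q r s) F ?G1"
    unfolding F using 1 N l by (intro conj_by_tensor refl conj_by_assoc) auto
  then have 01: "conj_by (A_cat N) (\<phi> N) (w q r s) F ?G1" by (simp add: N add.assoc)
  have "conj_by (A_cat (p + (q + r) + s)) (\<phi> (p + (q + r) + s)) (w p (q + r) s) ?G1 ?G2"
    using 1 N l loop_tensor[of q r g h] by (intro conj_by_assoc) auto
  then have 12: "conj_by (A_cat N) (\<phi> N) (w p (q + r) s) ?G1 ?G2" by (simp add: N add.assoc)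
  have "conj_by (A_cat (p + q + r + s)) (\<phi> (p + q + r + s)) (w p q r + 0) 
      (tensor (p + q + r) s (tensor p (q + r) f (tensor q r g h)) e) ?G3"
    using 1 N l by (intro conj_by_tensor refl conj_by_assoc) auto
  then have 23: "conj_by (A_cat N) (\<phi> N) (w p q r) ?G2 ?G3" by (simp add: N add.assoc)
  have "conj_by (A_cat (p + q + r + s)) (\<phi> (p + q + r + s)) (w (p + q) r s) ?G4 ?G3"
    using 1 N l loop_tensor[of p q f g] by (intro conj_by_assoc) auto
  then have "conj_by (A_cat N) (\<phi> N) (w (p + q) r s) ?G4 ?G3" by (simp add: N)
  \<comment> \<open>This edge and the one from \<open>?G4\<close> to \<open>F\<close> are
    associativity moves traversed backwards, which gives the two minus signs.\<close>
  then have 34: "conj_by (A_cat N) (\<phi> N) (- w (p + q) r s) ?G3 ?G4" by (rule conj_by_sym)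
  have "conj_by (A_cat (p + q + (r + s))) (\<phi> (p + q + (r + s))) (w p q (r + s))
      (tensor p (q + (r + s)) f (tensor q (r + s) g (tensor r s h e))) ?G4"
    using 1 N l loop_tensor[of r s h e] by (intro conj_by_assoc) auto
  then have "conj_by (A_cat N) (\<phi> N) (w p q (r + s)) F ?G4" by (simp add: N F add.assoc)
  then have 40: "conj_by (A_cat N) (\<phi> N) (- w p q (r + s)) ?G4 F" by (rule conj_by_sym)
  show ?thesis
    using conj_by_trans[OF conj_by_trans[OF conj_by_trans[OF conj_by_trans[OF 01 12] 23] 34] 40]
    by (simp add: algebra_simps)
qed

end

section \<open>The two independent commuting loops\<close>

lemma A_cat_nonempty: "1 \<le> n \<Longrightarrow> \<exists>x. x \<in> Obj (A_cat n)"
proof (induction n rule: less_induct)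
  case (less n)
  show ?case
  proof (cases "n = 1")
    case True
    then show ?thesis by (simp add: T1[simplified] one_cat_def)
  next
    case False
    interpret catalan_stage "{1..}" n by (rule catalan_stageI) (use False less.prems in simp)
    have "1 < n" "1 \<le> n - 1" "n - 1 < n" using False less.prems by auto
    then obtain x y where "x \<in> Obj (A_cat 1)" "y \<in> Obj (A_cat (n - 1))"
      using less.IH[of 1] less.IH[of "n - 1"] by blast
    then have "((1, n - 1), (x, y)) \<in> Obj (pair_cat n A_cat)"
      using False less.prems by (auto simp: pair_carr pairs_def)
    then show ?thesis using cat_functor.ob_in[OF U_functor[folded A_cat_def]] by blast
  qed
qed

text \<open>The pentagons with blocks \<open>(1, 1, 1, 1)\<close> and \<open>(4, 1, 1, k)\<close> each have exactly one move of nonzero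
  weight, of weights \<open>(0, 1)\<close> and \<open>(1, 0)\<close>.\<close>

definition block_weight :: "nat \<Rightarrow> nat \<Rightarrow> nat \<Rightarrow> int \<times> int"
  where "block_weight i j k = (of_bool (i = 4 \<and> j = 2), of_bool (i = 1 \<and> j = 2))"

lemma pi_A_not_free:
  assumes n: "7 \<le> n"
  shows "\<not> is_free_group (pi_A n)"
proof -
  obtain \<phi> where wt: "\<And>m. 1 \<le> m \<Longrightarrow> m \<le> n \<Longrightarrow> weighting block_weight m \<phi>"
    using weighting_exists[of n block_weight] by blast
  interpret weighted_catalan block_weight \<phi> n by unfold_locales (rule wt)
  interpret A: additive_groupoid "A_cat n" "\<phi> n" using n by (intro additive_groupoid) auto
  have id: "loop m (Id (A_cat m) x) \<and> (1 \<le> m \<longrightarrow> m \<le> n \<longrightarrow> \<phi> m (Id (A_cat m) x) = 0)"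
    if "x \<in> Obj (A_cat m)" "1 \<le> m" for x m
    using stage_ok[of m "{1..}"] that additive_groupoid[THEN additive_groupoid.\<phi>_id]
    by (auto simp: stage_ok_def groupoid_def A_cat_def category.id_arr category.dom_id category.cod_id)
  \<comment> \<open>The fourth block of sizes (4, 1, 1, n - 6) must be positive; this is where the
    bound 7 comes from.\<close>
  have "1 \<le> n - 6" using n by simp
  then obtain x z where xz: "x \<in> Obj (A_cat 1)" "z \<in> Obj (A_cat (n - 6))"
    using A_cat_nonempty[of 1] A_cat_nonempty[of "n - 6"] by blast
  define e where "e = Id (A_cat 1) x"
  define c where "c = Id (A_cat (n - 6)) z"
  have e: "loop 1 e" "\<phi> 1 e = 0" and c: "loop (n - 6) c" "\<phi> (n - 6) c = 0"
    using id[OF xz(1)] id[OF xz(2)] n by (auto simp: e_def c_def)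
  \<comment> \<open>All four factors are identities of \<open>A_cat 1\<close>; the conjugating arrow
    u is the inner pentagon loop.\<close>
  have "conj_by (A_cat 4) (\<phi> 4) (0, 1) F F"
    if "F = tensor 1 (1 + 1 + 1) e (tensor 1 (1 + 1) e (tensor 1 1 e e))" for F
    using conj_by_pentagon[of 1 1 1 1 4 e e e e F] n e(1) that by (simp add: block_weight_def)
  then obtain u where u: "loop 4 u" "\<phi> 4 u = (0, 1)"
    unfolding conj_by_def by metis
  have sizes: "1 + (n - 6) = n - 5" "1 + (n - 5) = n - 4" "4 + (n - 4) = n" "1 + 1 + (n - 6) = n - 4"
    using n by auto
  define g where "g = tensor 1 (n - 6) e c"
  define h where "h = tensor 1 (n - 5) e g"
  \<comment> \<open>The inner pentagon acts on the first block while the other three blocks carry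
    identities, so f inherits the weight of u.\<close>
  define f where "f = tensor 4 (n - 4) u h"
  have "f = tensor 4 (1 + 1 + (n - 6)) u (tensor 1 (1 + (n - 6)) e (tensor 1 (n - 6) e c))"
    unfolding sizes f_def h_def g_def ..
  then have "conj_by (A_cat n) (\<phi> n) (1, 0) f f"
    using conj_by_pentagon[of 4 1 1 "n - 6" n u e e c f] n e(1) c(1) u(1)
    by (simp add: block_weight_def)
  \<comment> \<open>The outer pentagon loop v commutes with f by naturality.\<close>
  then obtain v where v: "loop n v" "Dom (A_cat n) v = Dom (A_cat n) f" "loop n f"
    "Comp (A_cat n) f v = Comp (A_cat n) v f" "\<phi> n v = (1, 0)"
    unfolding conj_by_def by metis
  have g: "loop (n - 5) g" "\<phi> (n - 5) g = 0"
    using weight_tensor[of 1 "n - 6" e c, unfolded sizes] loop_tensor[of 1 "n - 6" e c, unfolded sizes] n e c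
    by (auto simp: g_def)
  have h: "loop (n - 4) h" "\<phi> (n - 4) h = 0"
    using weight_tensor[of 1 "n - 5" e g, unfolded sizes] loop_tensor[of 1 "n - 5" e g, unfolded sizes] n e g
    by (auto simp: h_def)
  have f: "\<phi> n f = (0, 1)"
    using weight_tensor[of 4 "n - 4" u h, unfolded sizes] n u h by (simp add: f_def)
  interpret pushout_square "T_cat n" one_cat "A_cat n" to_one "L_ftr n"
    using n by (intro pi_A_pushout) simp
  interpret inE: cat_functor "A_cat n" Po inE by (rule inE_functor)
  \<comment> \<open>Both coordinates of \<open>block_weight\<close> require j = 2, so moves with j =
    1 have weight 0.\<close>
  have van: "\<phi> n (ar (L_ftr n) t) = 0" if "t \<in> Arr (T_cat n)" for t
    by (rule weighting_vanishes_on_T[OF _ wt])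
      (use n that in \<open>auto simp: block_weight_def zero_prod_def\<close>)
  have "1 \<le> n" using n by simp
  from pi_A_additive[OF this A.additive van] obtain \<psi>
    where hom: "\<forall>x\<in>carrier (pi_A n). \<forall>y\<in>carrier (pi_A n). \<psi> (x \<otimes>\<^bsub>pi_A n\<^esub> y) = \<psi> x + \<psi> y"
      and \<psi>: "\<forall>f\<in>Arr (A_cat n). \<psi> (ar inE f) = \<phi> n f"
    by blast
  show ?thesis
  proof (rule not_free_if_commuting_independent[where \<phi> = \<psi>])
    show "group (pi_A n)" using n by (intro pi_group) simp
    show "ar inE v \<in> carrier (pi_A n)" "ar inE f \<in> carrier (pi_A n)"
      using v by (simp_all add: pi_A_carrier inE.ar_in)
    show "ar inE v \<otimes>\<^bsub>pi_A n\<^esub> ar inE f = ar inE f \<otimes>\<^bsub>pi_A n\<^esub> ar inE v"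
      using inE.ar_comp[of f v] inE.ar_comp[of v f] v by (simp add: pi_A_carrier)
    \<comment> \<open>The weights of v and f are (1, 0) and (0, 1), so the determinant is 1.\<close>
    show "fst (\<psi> (ar inE v)) * snd (\<psi> (ar inE f)) \<noteq> fst (\<psi> (ar inE f)) * snd (\<psi> (ar inE v))"
      using \<psi> v f by simp
  qed (use hom in blast)
qed

theorem mainTheorem6:
  shows "\<not> is_free_group (pi_A 7) \<and> (\<forall>n\<ge>7. \<not> is_free_group (pi_A n))"
  using pi_A_not_free by simp

end
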